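(* Let $(V,\sigma)$ be a pre-braided vector space over a field $\Bbbk$ with braided characters $\epsilon,\xi,\zeta$, where $\epsilon$ and $\xi$ are $\sigma$-compatible, and $\zeta$ is right $\sigma$-compatible with an element $w\in V$. Let $\bar v$ denote any pure tensor in $V^{\otimes n}$. (1) The arrow operation ${}^{\epsilon}\pi_w$ is a bicomplex map for $(T(V),{}^{\xi}d,d^{\zeta})$, i.e. $${}^{\xi}d\circ{}^{\epsilon}\pi_w(\bar v)={}^{\epsilon}\pi_w\circ{}^{\xi}d(\bar v),\qquad d^{\zeta}\circ{}^{\epsilon}\pi_w(\bar v)={}^{\epsilon}\pi_w\circ d^{\zeta}(\bar v).$$ (2) One has $${}^{\epsilon}d(\bar vw)={}^{\epsilon}d(\bar v)w+(-1)^n\,{}^{\epsilon}\pi_w(\bar v),\qquad d^{\zeta}(\bar vw)=d^{\zeta}(\bar v)w+(-1)^n\zeta(w)\bar v.$$ (3) If $\sigma$ is demi-natural with respect to $w$, then ${}^{\epsilon}\pi_w=\epsilon(w)\,\mathrm{Id}_{T(V)}$.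
   Context: $T(V)=\bigoplus_{n\ge0}V^{\otimes n}$, $V^{\otimes0}=\Bbbk$; $\bar vw$ is the concatenation $\bar v\otimes w\in V^{\otimes(n+1)}$. For a linear map $\varphi:V^{\otimes l}\to V^{\otimes r}$, $\varphi_i=\mathrm{Id}_{V^{\otimes(i-1)}}\otimes\varphi\otimes\mathrm{Id}$. A pre-braiding on $V$ is a linear map $\sigma:V\otimes V\to V\otimes V$ (not necessarily invertible) with $\sigma_1\sigma_2\sigma_1=\sigma_2\sigma_1\sigma_2$ on $V^{\otimes 3}$; then $-\sigma$ is also a pre-braiding. A braided character is $\epsilon\in V^*$ with $(\epsilon\otimes\epsilon)\circ\sigma=\epsilon\otimes\epsilon$. Elements $f,g\in V^*$ are $\sigma$-compatible if $(f\otimes g)\circ\sigma=g\otimes f$ and $(g\otimes f)\circ\sigma=f\otimes g$. An element $w\in V$ and $\psi\in V^*$ are right $\sigma$-compatible if $(\mathrm{Id}_V\otimes\psi)(\sigma(v\otimes w))=\psi(v)w$ for all $v\in V$. $\sigma$ is demi-natural with respect to $w$ if $\sigma(v\otimes w)=w\otimes v$ for all $v\in V$. For a pre-braiding $\beta$ and $s\in S_n$ with shortest expression $s=\tau_{i_1}\cdots\tau_{i_k}$ in adjacent transpositions $\tau_i=(i\ i{+}1)$, $T_s^{\beta}=\beta_{i_1}\circ\cdots\circ\beta_{i_k}$ on $V^{\otimes n}$. With $Sh_{p,q}=\{s\in S_{p+q}: s(1)<\dots<s(p),\ s(p+1)<\dots<s(p+q)\}$, $\mathrm{csh}_{\beta}^{p,q}=\sum_{s\in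 Sh_{p,q}}T^{\beta}_{s^{-1}}$. For a braided character $\epsilon$, on $V^{\otimes n}$ ($n\ge1$): ${}^{\epsilon}d=\epsilon_1\circ\mathrm{csh}_{-\sigma}^{1,n-1}$, $d^{\epsilon}=(-1)^{n-1}\epsilon_n\circ\mathrm{csh}_{-\sigma}^{n-1,1}$; both vanish on $V^{\otimes0}$. The arrow operation associated to $w\in V$ is ${}^{\epsilon}\pi_w(\bar v)=\epsilon_1\circ\sigma_1\circ\sigma_2\circ\cdots\circ\sigma_n(\bar vw)$ for $\bar v\in V^{\otimes n}$ (i.e. $w$ is moved from the rightmost to the leftmost position by $\sigma$ and then $\epsilon$ is applied to the first factor). *)

theory Defs
  imports Complex_Main "HOL-Library.Function_Algebras" "HOL-Combinatorics.Permutations"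
begin

section \<open>Tensor powers of a vector space\<close>

text \<open>
  Throughout, \<open>scale\<close> is the scalar multiplication of a vector space \<open>V\<close> over a field, and a list
  \<open>[v\<^sub>1, \<dots>, v\<^sub>n]\<close> stands for the argument tuple \<open>(v\<^sub>1, \<dots>, v\<^sub>n)\<close>.  A function on lists is called
  multilinear if its restriction to lists of each length \<open>n\<close> is \<open>n\<close>-linear (with no condition for
  \<open>n = 0\<close>).
\<close>

definition multilinear ::
  "('k::field \<Rightarrow> 'v::ab_group_add \<Rightarrow> 'v) \<Rightarrow> ('k \<Rightarrow> 'w::ab_group_add \<Rightarrow> 'w) \<Rightarrow> ('v list \<Rightarrow> 'w) \<Rightarrow> bool" where
  "multilinear scale scale' g \<longleftrightarrow>
     (\<forall>us vs. Vector_Spaces.linear scale scale' (\<lambda>v. g (us @ v # vs)))"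

text \<open>
  The tensor algebra is realised concretely: the pure tensor \<open>v\<^sub>1 \<otimes> \<dots> \<otimes> v\<^sub>n\<close> is the evaluation
  \<open>f \<mapsto> f [v\<^sub>1, \<dots>, v\<^sub>n]\<close> of multilinear forms, and the tensor powers are the spans of the pure
  tensors inside the space of all functionals, with the pointwise operations.  Values at arguments
  \<open>f\<close> that are not multilinear are set to \<open>0\<close>.  That this is indeed \<open>T(V) = \<Oplus>\<^sub>n V\<^sup>\<otimes>\<^sup>n\<close> is the content
  of the universal property \<open>tensor_algebra_universal\<close> below.
\<close>

type_synonym ('k, 'v) tensor = "('v list \<Rightarrow> 'k) \<Rightarrow> 'k"

definition tscale :: "'k::field \<Rightarrow> ('k, 'v) tensor \<Rightarrow> ('k, 'v) tensor" where
  "tscale c t = (\<lambda>f. c * t f)"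

definition pure_tensor ::
  "('k::field \<Rightarrow> 'v::ab_group_add \<Rightarrow> 'v) \<Rightarrow> 'v list \<Rightarrow> ('k, 'v) tensor" where
  "pure_tensor scale vs = (\<lambda>f. if multilinear scale (*) f then f vs else 0)"

definition tensor_power ::
  "('k::field \<Rightarrow> 'v::ab_group_add \<Rightarrow> 'v) \<Rightarrow> nat \<Rightarrow> ('k, 'v) tensor set" where
  "tensor_power scale n = module.span tscale (pure_tensor scale ` {vs. length vs = n})"

definition tensor_algebra ::
  "('k::field \<Rightarrow> 'v::ab_group_add \<Rightarrow> 'v) \<Rightarrow> ('k, 'v) tensor set" where
  "tensor_algebra scale = module.span tscale (range (pure_tensor scale))"

text \<open>
  For multilinear \<open>g\<close> with values in \<open>T(V)\<close>, this is the linear endomorphism of \<open>T(V)\<close> sending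
  \<open>v\<^sub>1 \<otimes> \<dots> \<otimes> v\<^sub>n\<close> to \<open>g [v\<^sub>1, \<dots>, v\<^sub>n]\<close>; see \<open>lin_ext_pure_tensor\<close> and \<open>linear_lin_ext\<close>.
\<close>

definition lin_ext ::
  "('v list \<Rightarrow> ('k::field, 'v) tensor) \<Rightarrow> ('k, 'v) tensor \<Rightarrow> ('k, 'v) tensor" where
  "lin_ext g t = (\<lambda>f. t (\<lambda>vs. g vs f))"

definition linear_between ::
  "('k::field, 'v) tensor set \<Rightarrow> ('k, 'v) tensor set \<Rightarrow>
   (('k, 'v) tensor \<Rightarrow> ('k, 'v) tensor) \<Rightarrow> bool" where
  "linear_between A B \<phi> \<longleftrightarrow>
     \<phi> ` A \<subseteq> B \<and> (\<forall>x\<in>A. \<forall>y\<in>A. \<phi> (x + y) = \<phi> x + \<phi> y) \<and>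
     (\<forall>c. \<forall>x\<in>A. \<phi> (tscale c x) = tscale c (\<phi> x))"

definition tensor_mult ::
  "('k::field \<Rightarrow> 'v::ab_group_add \<Rightarrow> 'v) \<Rightarrow> ('k, 'v) tensor \<Rightarrow> ('k, 'v) tensor \<Rightarrow> ('k, 'v) tensor" where
  "tensor_mult scale x y = lin_ext (\<lambda>us. lin_ext (\<lambda>vs. pure_tensor scale (us @ vs)) y) x"

text \<open>
  \<open>\<phi> \<otimes> \<psi>\<close> on \<open>V\<^sup>\<otimes>\<^sup>l \<otimes> V\<^sup>\<otimes>\<^sup>m = V\<^sup>\<otimes>\<^sup>(\<^sup>l\<^sup>+\<^sup>m\<^sup>)\<close>, for \<open>\<phi>\<close> linear on \<open>V\<^sup>\<otimes>\<^sup>l\<close> and \<open>\<psi>\<close> linear on \<open>V\<^sup>\<otimes>\<^sup>m\<close>,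
  extended by \<open>0\<close> to the other degrees.
\<close>

definition map_tensor ::
  "('k::field \<Rightarrow> 'v::ab_group_add \<Rightarrow> 'v) \<Rightarrow> nat \<Rightarrow> nat \<Rightarrow>
   (('k, 'v) tensor \<Rightarrow> ('k, 'v) tensor) \<Rightarrow> (('k, 'v) tensor \<Rightarrow> ('k, 'v) tensor) \<Rightarrow>
   ('k, 'v) tensor \<Rightarrow> ('k, 'v) tensor" where
  "map_tensor scale l m \<phi> \<psi> = lin_ext (\<lambda>vs.
     if length vs = l + m
     then tensor_mult scale (\<phi> (pure_tensor scale (take l vs))) (\<psi> (pure_tensor scale (drop l vs)))
     else 0)"

text \<open>
  \<open>act_at scale n l \<phi> i\<close> is \<open>\<phi>\<^sub>i = Id \<otimes> \<phi> \<otimes> Id\<close> on \<open>V\<^sup>\<otimes>\<^sup>n\<close>, for \<open>\<phi>\<close> linear on \<open>V\<^sup>\<otimes>\<^sup>l\<close> and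
  \<open>1 \<le> i \<le> n - l + 1\<close>.
\<close>

definition act_at ::
  "('k::field \<Rightarrow> 'v::ab_group_add \<Rightarrow> 'v) \<Rightarrow> nat \<Rightarrow> nat \<Rightarrow>
   (('k, 'v) tensor \<Rightarrow> ('k, 'v) tensor) \<Rightarrow> nat \<Rightarrow> ('k, 'v) tensor \<Rightarrow> ('k, 'v) tensor" where
  "act_at scale n l \<phi> i =
     map_tensor scale (i - 1) (n - (i - 1)) id (map_tensor scale l (n - (i - 1) - l) \<phi> id)"

text \<open>A linear form on \<open>V\<close>, viewed as a map from \<open>V\<^sup>\<otimes>\<^sup>1\<close> to \<open>V\<^sup>\<otimes>\<^sup>0\<close> (the line spanned by the empty tensor).\<close>

definition form_map ::
  "('k::field \<Rightarrow> 'v::ab_group_add \<Rightarrow> 'v) \<Rightarrow> ('v \<Rightarrow> 'k) \<Rightarrow> ('k, 'v) tensor \<Rightarrow> ('k, 'v) tensor" where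
  "form_map scale \<epsilon> =
     lin_ext (\<lambda>vs. if length vs = 1 then tscale (\<epsilon> (hd vs)) (pure_tensor scale []) else 0)"

text \<open>
  The map on \<open>T(V) = \<Oplus>\<^sub>n V\<^sup>\<otimes>\<^sup>n\<close> whose restriction to \<open>V\<^sup>\<otimes>\<^sup>n\<close> is \<open>D n\<close>.
\<close>

definition assemble ::
  "('k::field \<Rightarrow> 'v::ab_group_add \<Rightarrow> 'v) \<Rightarrow> (nat \<Rightarrow> ('k, 'v) tensor \<Rightarrow> ('k, 'v) tensor) \<Rightarrow>
   ('k, 'v) tensor \<Rightarrow> ('k, 'v) tensor" where
  "assemble scale D = lin_ext (\<lambda>vs. D (length vs) (pure_tensor scale vs))"


subsection \<open>The universal property\<close>

lemma vector_space_tscale: "vector_space (tscale :: 'k::field \<Rightarrow> ('k, 'v) tensor \<Rightarrow> _)"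
  by unfold_locales (auto simp: tscale_def fun_eq_iff algebra_simps)

lemma vector_space_mult: "vector_space ((*) :: 'k::field \<Rightarrow> 'k \<Rightarrow> 'k)"
  by unfold_locales (auto simp: algebra_simps)

lemma linear_iff':
  "Vector_Spaces.linear s1 s2 f \<longleftrightarrow> vector_space s1 \<and> vector_space s2 \<and>
     (\<forall>x y. f (x + y) = f x + f y) \<and> (\<forall>c x. f (s1 c x) = s2 c (f x))"
  by (auto simp: Vector_Spaces.linear_def module_hom_def module_hom_axioms_def module_iff_vector_space)

lemma linear_lin_ext: "Vector_Spaces.linear tscale tscale (lin_ext g)"
  by (auto simp: linear_iff' vector_space_tscale lin_ext_def tscale_def)

lemma multilinear_pure_tensor:
  assumes "vector_space scale"
  shows "multilinear scale tscale (pure_tensor scale)"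
  using assms
  by (auto simp: multilinear_def linear_iff' vector_space_tscale pure_tensor_def tscale_def fun_eq_iff)

lemma multilinear_compose:
  assumes "multilinear s1 s2 g" "Vector_Spaces.linear s2 s3 h"
  shows "multilinear s1 s3 (\<lambda>vs. h (g vs))"
  using assms by (auto simp: multilinear_def linear_iff')

lemma tensor_eval_linear: "Vector_Spaces.linear tscale (*) (\<lambda>t. t f)"
  by (auto simp: linear_iff' vector_space_tscale vector_space_mult tscale_def)

lemma tensor_algebra_nonmultilinear:
  assumes "t \<in> tensor_algebra scale" "\<not> multilinear scale (*) f"
  shows "t f = 0"
proof -
  interpret T: vector_space tscale by (rule vector_space_tscale)
  show ?thesis
    using assms(1) unfolding tensor_algebra_def
    by (induction rule: T.span_induct_alt) (use assms(2) in \<open>auto simp: pure_tensor_def tscale_def\<close>)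
qed

lemma lin_ext_pure_tensor:
  assumes "multilinear scale tscale g" "g vs \<in> tensor_algebra scale"
  shows "lin_ext g (pure_tensor scale vs) = g vs"
proof
  fix f
  show "lin_ext g (pure_tensor scale vs) f = g vs f"
    using multilinear_compose[OF assms(1) tensor_eval_linear[of f]]
    by (simp add: lin_ext_def pure_tensor_def)
qed

lemma tensor_mult_pure_tensor:
  assumes "vector_space scale"
  shows "tensor_mult scale (pure_tensor scale us) (pure_tensor scale vs) = pure_tensor scale (us @ vs)"
proof
  fix f
  show "tensor_mult scale (pure_tensor scale us) (pure_tensor scale vs) f = pure_tensor scale (us @ vs) f"
  proof (cases "multilinear scale (*) f")
    case True
    have "multilinear scale (*) (\<lambda>vs. f (us @ vs))" for us
      using True unfolding multilinear_def append.assoc[symmetric] by blast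
    moreover have "multilinear scale (*) (\<lambda>us. f (us @ vs))"
      using True by (simp add: multilinear_def)
    ultimately show ?thesis
      using True by (simp add: tensor_mult_def lin_ext_def pure_tensor_def)
  next
    case False
    then show ?thesis
      by (simp add: tensor_mult_def lin_ext_def pure_tensor_def)
  qed
qed

lemma exists_separating_form:
  assumes "vector_space s" and "x \<noteq> 0"
  obtains l where "Vector_Spaces.linear s (*) l" "l x \<noteq> 0"
proof -
  interpret vector_space_pair s "(*)"
    using assms(1) vector_space_mult by (simp add: vector_space_pair_def)
  have "vs1.independent {x}"
    using assms(2) by simp
  then obtain l where "Vector_Spaces.linear s (*) l" "\<forall>y\<in>{x}. l y = 1"
    using linear_independent_extend[of "{x}" "\<lambda>_. 1"] by blast
  then show thesis
    by (intro that) auto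
qed

theorem tensor_algebra_universal:
  assumes V: "vector_space scale" and g: "multilinear scale scale' g"
    and W: "vector_space scale'"
  shows "\<exists>h. Vector_Spaces.linear tscale scale' h \<and> (\<forall>vs. h (pure_tensor scale vs) = g vs) \<and>
           (\<forall>h'. Vector_Spaces.linear tscale scale' h' \<and> (\<forall>vs. h' (pure_tensor scale vs) = g vs) \<longrightarrow>
             (\<forall>t\<in>tensor_algebra scale. h' t = h t))"
proof -
  interpret TW: vector_space_pair tscale scale'
    using vector_space_tscale W by (simp add: vector_space_pair_def)
  interpret Tk: vector_space_pair tscale "(*)"
    using vector_space_tscale vector_space_mult by (simp add: vector_space_pair_def)
  let ?P = "range (pure_tensor scale)"
  obtain B where B: "B \<subseteq> ?P" "TW.vs1.independent B" "?P \<subseteq> TW.vs1.span B"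
    using TW.vs1.maximal_independent_subset by blast
  define r where "r b = (SOME vs. pure_tensor scale vs = b)" for b
  have r: "pure_tensor scale (r b) = b" if "b \<in> B" for b
    unfolding r_def by (rule someI_ex) (use that B(1) in blast)
  define h where "h = TW.construct B (\<lambda>b. g (r b))"
  have h: "Vector_Spaces.linear tscale scale' h"
    unfolding h_def using B(2) by (rule TW.linear_construct)
  have hB: "h b = g (r b)" if "b \<in> B" for b
    unfolding h_def using B(2) that by (rule TW.construct_basis)
  have hg: "h (pure_tensor scale vs) = g vs" for vs
  proof (rule ccontr)
    assume "h (pure_tensor scale vs) \<noteq> g vs"
    then have "h (pure_tensor scale vs) - g vs \<noteq> 0"
      by simp
    then obtain l where l: "Vector_Spaces.linear scale' (*) l"
        "l (h (pure_tensor scale vs) - g vs) \<noteq> 0"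
      by (rule exists_separating_form[OF W])
    let ?f = "\<lambda>us. l (g us)"
    have f: "multilinear scale (*) ?f"
      using g l(1) by (rule multilinear_compose)
    have "l (h t) = t ?f" if "t \<in> TW.vs1.span B" for t
    proof (rule Tk.linear_eq_on[OF _ _ that])
      show "Vector_Spaces.linear tscale (*) (\<lambda>t. l (h t))"
        using h l(1) by (auto simp: linear_iff')
      show "Vector_Spaces.linear tscale (*) (\<lambda>t. t ?f)"
        by (rule tensor_eval_linear)
      fix b assume b: "b \<in> B"
      show "l (h b) = b ?f"
        unfolding hB[OF b] using f by (subst r[OF b, symmetric]) (simp add: pure_tensor_def)
    qed
    then have "l (h (pure_tensor scale vs)) = pure_tensor scale vs ?f"
      using B(3) by blast
    also have "\<dots> = l (g vs)"
      using f by (simp add: pure_tensor_def)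
    finally have "l (h (pure_tensor scale vs)) - l (g vs) = 0"
      by simp
    moreover have "module_hom scale' (*) l"
      using l(1) by (simp add: Vector_Spaces.linear_def)
    ultimately show False
      using l(2) module_hom.diff by metis
  qed
  show ?thesis
  proof (intro exI[of _ h] conjI allI impI ballI)
    fix h' t
    assume h': "Vector_Spaces.linear tscale scale' h' \<and> (\<forall>vs. h' (pure_tensor scale vs) = g vs)"
      and t: "t \<in> tensor_algebra scale"
    have h'_lin: "Vector_Spaces.linear tscale scale' h'"
      using h' by simp
    have t_span: "t \<in> TW.vs1.span ?P"
      using t by (simp add: tensor_algebra_def)
    show "h' t = h t"
    proof (rule TW.linear_eq_on[OF h'_lin h t_span])
      show "h' b = h b" if "b \<in> ?P" for b
        using that h' hg by auto
    qed
  qed (rule h, rule hg)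
qed


section \<open>Pre-braidings\<close>

definition pre_braiding ::
  "('k::field \<Rightarrow> 'v::ab_group_add \<Rightarrow> 'v) \<Rightarrow> (('k, 'v) tensor \<Rightarrow> ('k, 'v) tensor) \<Rightarrow> bool" where
  "pre_braiding scale \<sigma> \<longleftrightarrow>
     linear_between (tensor_power scale 2) (tensor_power scale 2) \<sigma> \<and>
     (let s = act_at scale 3 2 \<sigma>
      in \<forall>x\<in>tensor_power scale 3. s 1 (s 2 (s 1 x)) = s 2 (s 1 (s 2 x)))"

text \<open>\<open>f \<otimes> g\<close> as a map from \<open>V\<^sup>\<otimes>\<^sup>2\<close> to \<open>V\<^sup>\<otimes>\<^sup>0\<close>.\<close>

definition form2 ::
  "('k::field \<Rightarrow> 'v::ab_group_add \<Rightarrow> 'v) \<Rightarrow> ('v \<Rightarrow> 'k) \<Rightarrow> ('v \<Rightarrow> 'k) \<Rightarrow>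
   ('k, 'v) tensor \<Rightarrow> ('k, 'v) tensor" where
  "form2 scale f g = map_tensor scale 1 1 (form_map scale f) (form_map scale g)"

definition braided_character ::
  "('k::field \<Rightarrow> 'v::ab_group_add \<Rightarrow> 'v) \<Rightarrow> (('k, 'v) tensor \<Rightarrow> ('k, 'v) tensor) \<Rightarrow> ('v \<Rightarrow> 'k) \<Rightarrow> bool" where
  "braided_character scale \<sigma> \<epsilon> \<longleftrightarrow> Vector_Spaces.linear scale (*) \<epsilon> \<and>
     (\<forall>x\<in>tensor_power scale 2. form2 scale \<epsilon> \<epsilon> (\<sigma> x) = form2 scale \<epsilon> \<epsilon> x)"

definition compatible_forms ::
  "('k::field \<Rightarrow> 'v::ab_group_add \<Rightarrow> 'v) \<Rightarrow> (('k, 'v) tensor \<Rightarrow> ('k, 'v) tensor) \<Rightarrow>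
   ('v \<Rightarrow> 'k) \<Rightarrow> ('v \<Rightarrow> 'k) \<Rightarrow> bool" where
  "compatible_forms scale \<sigma> f g \<longleftrightarrow>
     (\<forall>x\<in>tensor_power scale 2. form2 scale f g (\<sigma> x) = form2 scale g f x \<and>
                               form2 scale g f (\<sigma> x) = form2 scale f g x)"

definition right_compatible ::
  "('k::field \<Rightarrow> 'v::ab_group_add \<Rightarrow> 'v) \<Rightarrow> (('k, 'v) tensor \<Rightarrow> ('k, 'v) tensor) \<Rightarrow> 'v \<Rightarrow> ('v \<Rightarrow> 'k) \<Rightarrow> bool" where
  "right_compatible scale \<sigma> w \<psi> \<longleftrightarrow>
     (\<forall>v. map_tensor scale 1 1 id (form_map scale \<psi>) (\<sigma> (pure_tensor scale [v, w])) =
          tscale (\<psi> v) (pure_tensor scale [w]))"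

definition demi_natural ::
  "('k::field \<Rightarrow> 'v::ab_group_add \<Rightarrow> 'v) \<Rightarrow> (('k, 'v) tensor \<Rightarrow> ('k, 'v) tensor) \<Rightarrow> 'v \<Rightarrow> bool" where
  "demi_natural scale \<sigma> w \<longleftrightarrow> (\<forall>v. \<sigma> (pure_tensor scale [v, w]) = pure_tensor scale [w, v])"


section \<open>Quantum shuffles and the braided differentials\<close>

text \<open>The permutation \<open>\<tau>\<^sub>i\<^sub>1 \<circ> \<dots> \<circ> \<tau>\<^sub>i\<^sub>k\<close> for a word \<open>[i\<^sub>1, \<dots>, i\<^sub>k]\<close>, where \<open>\<tau>\<^sub>i = (i i+1)\<close>.\<close>

definition word_perm :: "nat list \<Rightarrow> nat \<Rightarrow> nat" where
  "word_perm is = foldr (\<lambda>i p. Transposition.transpose i (i + 1) \<circ> p) is id"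

definition shortest_word :: "nat \<Rightarrow> (nat \<Rightarrow> nat) \<Rightarrow> nat list" where
  "shortest_word n s = (ARG_MIN length is. set is \<subseteq> {1..<n} \<and> word_perm is = s)"

text \<open>
  \<open>T\<^sub>s\<^sup>\<beta>\<close> on \<open>V\<^sup>\<otimes>\<^sup>n\<close>.  The braid relation for \<open>\<beta>\<close> makes the result independent of the choice of the
  shortest expression.
\<close>

definition braid_lift ::
  "('k::field \<Rightarrow> 'v::ab_group_add \<Rightarrow> 'v) \<Rightarrow> (('k, 'v) tensor \<Rightarrow> ('k, 'v) tensor) \<Rightarrow> nat \<Rightarrow>
   (nat \<Rightarrow> nat) \<Rightarrow> ('k, 'v) tensor \<Rightarrow> ('k, 'v) tensor" where
  "braid_lift scale \<beta> n s = foldr (\<lambda>i F. act_at scale n 2 \<beta> i \<circ> F) (shortest_word n s) id"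

definition shuffles_perm :: "nat \<Rightarrow> nat \<Rightarrow> (nat \<Rightarrow> nat) set" where
  "shuffles_perm p q = {s. s permutes {1..p + q} \<and>
     strict_mono_on {1..p} s \<and> strict_mono_on {p + 1..p + q} s}"

definition csh ::
  "('k::field \<Rightarrow> 'v::ab_group_add \<Rightarrow> 'v) \<Rightarrow> (('k, 'v) tensor \<Rightarrow> ('k, 'v) tensor) \<Rightarrow> nat \<Rightarrow> nat \<Rightarrow>
   ('k, 'v) tensor \<Rightarrow> ('k, 'v) tensor" where
  "csh scale \<beta> p q x = (\<Sum>s\<in>shuffles_perm p q. braid_lift scale \<beta> (p + q) (inv s) x)"

definition left_d ::
  "('k::field \<Rightarrow> 'v::ab_group_add \<Rightarrow> 'v) \<Rightarrow> (('k, 'v) tensor \<Rightarrow> ('k, 'v) tensor) \<Rightarrow> ('v \<Rightarrow> 'k) \<Rightarrow>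
   ('k, 'v) tensor \<Rightarrow> ('k, 'v) tensor" where
  "left_d scale \<sigma> \<epsilon> = assemble scale (\<lambda>n x.
     if n = 0 then 0
     else act_at scale n 1 (form_map scale \<epsilon>) 1 (csh scale (- \<sigma>) 1 (n - 1) x))"

definition right_d ::
  "('k::field \<Rightarrow> 'v::ab_group_add \<Rightarrow> 'v) \<Rightarrow> (('k, 'v) tensor \<Rightarrow> ('k, 'v) tensor) \<Rightarrow> ('v \<Rightarrow> 'k) \<Rightarrow>
   ('k, 'v) tensor \<Rightarrow> ('k, 'v) tensor" where
  "right_d scale \<sigma> \<epsilon> = assemble scale (\<lambda>n x.
     if n = 0 then 0
     else tscale ((-1) ^ (n - 1))
            (act_at scale n 1 (form_map scale \<epsilon>) n (csh scale (- \<sigma>) (n - 1) 1 x)))"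

definition arrow_op ::
  "('k::field \<Rightarrow> 'v::ab_group_add \<Rightarrow> 'v) \<Rightarrow> (('k, 'v) tensor \<Rightarrow> ('k, 'v) tensor) \<Rightarrow> ('v \<Rightarrow> 'k) \<Rightarrow> 'v \<Rightarrow>
   ('k, 'v) tensor \<Rightarrow> ('k, 'v) tensor" where
  "arrow_op scale \<sigma> \<epsilon> w = assemble scale (\<lambda>n x.
     act_at scale (n + 1) 1 (form_map scale \<epsilon>) 1
       (foldr (act_at scale (n + 1) 2 \<sigma>) [1..<n + 1] (tensor_mult scale x (pure_tensor scale [w]))))"

text \<open>
  A bicomplex map on \<open>T(V)\<close> with the differentials \<open>d\<close> and \<open>d'\<close>: a linear map of degree \<open>0\<close>
  commuting with both.
\<close>

definition bicomplex_map ::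
  "('k::field \<Rightarrow> 'v::ab_group_add \<Rightarrow> 'v) \<Rightarrow> (('k, 'v) tensor \<Rightarrow> ('k, 'v) tensor) \<Rightarrow>
   (('k, 'v) tensor \<Rightarrow> ('k, 'v) tensor) \<Rightarrow> (('k, 'v) tensor \<Rightarrow> ('k, 'v) tensor) \<Rightarrow> bool" where
  "bicomplex_map scale d d' \<phi> \<longleftrightarrow>
     linear_between (tensor_algebra scale) (tensor_algebra scale) \<phi> \<and>
     (\<forall>n. \<phi> ` tensor_power scale n \<subseteq> tensor_power scale n) \<and>
     (\<forall>x\<in>tensor_algebra scale. d (\<phi> x) = \<phi> (d x) \<and> d' (\<phi> x) = \<phi> (d' x))"

end

theory Submission
  imports Defs
begin

text \<open>
  Everything is reduced to words in the operators \<open>\<sigma>\<^sub>i\<close> and in linear forms applied to a single factor.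
  A \<open>(1, n - 1)\<close>- or \<open>(n - 1, 1)\<close>-shuffle is determined by where its single letter goes, and its inverse
  has a unique shortest word: \<open>\<tau>\<^sub>1 \<cdots> \<tau>\<^sub>k\<^sub>-\<^sub>1\<close> in the first case and \<open>\<tau>\<^sub>n\<^sub>-\<^sub>1 \<cdots> \<tau>\<^sub>k\<close> in the second
  (\<open>sum_shuffles_one_left\<close>, \<open>sum_shuffles_one_right\<close>, \<open>shortest_word_upt\<close>,
  \<open>shortest_word_rev_upt\<close>).  With the signs from \<open>- \<sigma>\<close> this gives, on \<open>V\<^sup>\<otimes>\<^sup>n\<close>, the differential built from
  \<open>\<epsilon>\<close> on the left as \<open>\<Sum>\<^sub>k (- 1)\<^sup>k\<^sup>-\<^sup>1 \<epsilon>\<^sub>1 \<sigma>\<^sub>1 \<cdots> \<sigma>\<^sub>k\<^sub>-\<^sub>1\<close>, and the one built from \<open>\<zeta>\<close> on the right as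
  \<open>\<Sum>\<^sub>k (- 1)\<^sup>k\<^sup>-\<^sup>1 \<zeta>\<^sub>n \<sigma>\<^sub>n\<^sub>-\<^sub>1 \<cdots> \<sigma>\<^sub>k\<close> (\<open>left_d_eq\<close>, \<open>right_d_eq\<close>).

  Part (2) is then read off from the sums in degree \<open>n + 1\<close>: in the left differential the terms with
  \<open>k \<le> n\<close> ignore \<open>w\<close> and the term \<open>k = n + 1\<close> is the arrow operation; in the right differential right
  compatibility removes the crossing of the \<open>k\<close>-th factor with \<open>w\<close>, and the term \<open>k = n + 1\<close> gives the
    factor \<open>\<zeta> w\<close>.

  Part (1) holds for each \<open>k\<close> separately.  It rests on three facts: operators on disjoint blocks of
  factors commute (\<open>act_at_interchange\<close>); \<open>(\<sigma>\<^sub>1 \<cdots> \<sigma>\<^sub>n) \<sigma>\<^sub>i = \<sigma>\<^sub>i\<^sub>+\<^sub>1 (\<sigma>\<^sub>1 \<cdots> \<sigma>\<^sub>n)\<close> for \<open>i < n\<close>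
  (\<open>foldr_braid_shift\<close>), which is the braid relation; and the compatibility of the forms with \<open>\<sigma>\<close>,
  which handles the one crossing in which both the moving factor and \<open>w\<close> are involved
  (\<open>left_term_arrow_op\<close>, \<open>right_term_arrow_op\<close>).

  Part (3) follows by moving \<open>w\<close> to the front one step at a time.

  The operators are handled through one rule: \<open>\<phi>\<^sub>i\<close> sends \<open>x \<otimes> y \<otimes> z\<close> to \<open>x \<otimes> \<phi> y \<otimes> z\<close> whenever \<open>y\<close> has
  the degree on which \<open>\<phi>\<close> is defined (\<open>act_at_mult\<close>), for arbitrary and not only pure \<open>x\<close>, \<open>y\<close>, \<open>z\<close>.
\<close>

(* Tensors are functions, and unfolding their sums pointwise would destroy the
   linear structure that the proofs below compute with. *)
declare zero_fun_apply [simp del] plus_fun_apply [simp del] uminus_apply [simp del]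


section \<open>Linear and multilinear maps\<close>

lemma linear_betweenD:
  assumes "linear_between A B f" "x \<in> A"
  shows "f x \<in> B" "y \<in> A \<Longrightarrow> f (x + y) = f x + f y" "f (tscale c x) = tscale c (f x)"
  using assms by (auto simp: linear_between_def)

lemma linear_between_comp:
  assumes "linear_between A B f" "linear_between B C g"
  shows "linear_between A C (\<lambda>x. g (f x))"
  using assms unfolding linear_between_def image_subset_iff by simp

lemma linear_between_mono:
  "linear_between A B f \<Longrightarrow> B \<subseteq> C \<Longrightarrow> linear_between A C f"
  unfolding linear_between_def by (meson order_trans)

lemma linear_tscaleD:
  assumes "Vector_Spaces.linear tscale tscale h"
  shows "h (x + y) = h x + h y" "h (tscale c x) = tscale c (h x)"
  using assms unfolding linear_iff' by blast+

lemma linear_between_linearI: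
  assumes "Vector_Spaces.linear tscale tscale f" "\<And>x. x \<in> A \<Longrightarrow> f x \<in> B"
  shows "linear_between A B f"
  using assms by (auto simp: linear_iff' linear_between_def)

lemma multilinear_add:
  assumes "multilinear s1 s2 f" "multilinear s1 s2 g"
  shows "multilinear s1 s2 (\<lambda>vs. f vs + g vs)"
  using assms unfolding multilinear_def linear_iff'
  by (auto simp: algebra_simps vector_space.vector_space_assms(1))

lemma multilinear_scale:
  fixes f :: "'v::ab_group_add list \<Rightarrow> 'k::field"
  assumes "multilinear s1 (*) f"
  shows "multilinear s1 (*) (\<lambda>vs. c * f vs)"
  using assms unfolding multilinear_def linear_iff'
  by (auto simp: algebra_simps)

lemma multilinear_zero:
  assumes "vector_space s1" "vector_space s2"
  shows "multilinear s1 s2 (\<lambda>vs. 0)"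
  using assms unfolding multilinear_def linear_iff'
  by (auto simp: module.scale_zero_right module_iff_vector_space)


section \<open>The tensor algebra and its product\<close>

locale tensor_space =
  fixes scale :: "'k::field \<Rightarrow> 'v::ab_group_add \<Rightarrow> 'v"
  assumes vector_space_scale: "vector_space scale"
begin

sublocale T: vector_space "tscale :: 'k \<Rightarrow> ('k, 'v) tensor \<Rightarrow> _"
  by (rule vector_space_tscale)

abbreviation P :: "'v list \<Rightarrow> ('k, 'v) tensor" where "P \<equiv> pure_tensor scale"
abbreviation TP :: "nat \<Rightarrow> ('k, 'v) tensor set" where "TP \<equiv> tensor_power scale"
abbreviation TA :: "('k, 'v) tensor set" where "TA \<equiv> tensor_algebra scale"
abbreviation mult (infixr "\<odot>" 72) where "x \<odot> y \<equiv> tensor_mult scale x y"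

lemma pure_in_power [intro, simp]: "length vs = n \<Longrightarrow> P vs \<in> TP n"
  unfolding tensor_power_def by (intro T.span_base) auto

lemma pure_in_algebra [intro, simp]: "P vs \<in> TA"
  unfolding tensor_algebra_def by (intro T.span_base) auto

lemma power_subset_algebra: "TP n \<subseteq> TA"
  unfolding tensor_power_def tensor_algebra_def by (intro T.span_mono) auto

lemma power_in_algebra [intro]: "x \<in> TP n \<Longrightarrow> x \<in> TA"
  using power_subset_algebra by blast

lemma zero_in_power [simp]: "0 \<in> TP n"
  and add_in_power: "x \<in> TP n \<Longrightarrow> y \<in> TP n \<Longrightarrow> x + y \<in> TP n"
  and scale_in_power: "x \<in> TP n \<Longrightarrow> tscale c x \<in> TP n"
  and sum_in_power: "(\<And>i. i \<in> I \<Longrightarrow> f i \<in> TP n) \<Longrightarrow> sum f I \<in> TP n"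
  unfolding tensor_power_def
  by (auto intro: T.span_zero T.span_add T.span_scale T.span_sum)

lemma zero_in_algebra [simp]: "0 \<in> TA"
  and add_in_algebra: "x \<in> TA \<Longrightarrow> y \<in> TA \<Longrightarrow> x + y \<in> TA"
  and scale_in_algebra: "x \<in> TA \<Longrightarrow> tscale c x \<in> TA"
  unfolding tensor_algebra_def
  by (auto intro: T.span_zero T.span_add T.span_scale)

lemma power_induct [consumes 1, case_names zero add]:
  assumes "x \<in> TP n" "Q 0"
    and "\<And>c vs y. length vs = n \<Longrightarrow> y \<in> TP n \<Longrightarrow> Q y \<Longrightarrow> Q (tscale c (P vs) + y)"
  shows "Q x"
proof -
  have "x \<in> TP n \<and> Q x"
    using assms(1) unfolding tensor_power_def
  proof (induction rule: T.span_induct_alt)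
    case base
    then show ?case using assms(2) by (simp add: T.span_zero)
  next
    case (step c x y)
    then show ?case
      using assms(3)[of _ y c] by (auto simp: tensor_power_def intro!: T.span_add T.span_scale intro: T.span_base)
  qed
  then show ?thesis by simp
qed

lemma algebra_induct [consumes 1, case_names zero add]:
  assumes "x \<in> TA" "Q 0"
    and "\<And>c vs y. y \<in> TA \<Longrightarrow> Q y \<Longrightarrow> Q (tscale c (P vs) + y)"
  shows "Q x"
proof -
  have "x \<in> TA \<and> Q x"
    using assms(1) unfolding tensor_algebra_def
  proof (induction rule: T.span_induct_alt)
    case base
    then show ?case using assms(2) by (simp add: T.span_zero)
  next
    case (step c x y)
    then show ?case
      using assms(3)[of y c] by (auto simp: tensor_algebra_def intro!: T.span_add T.span_scale intro: T.span_base)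
  qed
  then show ?thesis by simp
qed

lemma linear_between_zero: "linear_between (TP n) B f \<Longrightarrow> f 0 = 0"
  using linear_betweenD(3)[of "TP n" B f 0 0] by simp

lemma linear_eq_on_power:
  assumes "x \<in> TP n" "linear_between (TP n) B f" "linear_between (TP n) C g"
    and "\<And>vs. length vs = n \<Longrightarrow> f (P vs) = g (P vs)"
  shows "f x = g x"
  using assms(1)
proof (induction rule: power_induct)
  case zero
  then show ?case using assms(2,3) by (simp add: linear_between_zero)
next
  case (add c vs y)
  then show ?case
    by (simp add: linear_betweenD[OF assms(2)] linear_betweenD[OF assms(3)] scale_in_power assms(4))
qed

lemma power_mem_on_generators:
  assumes "x \<in> TP n" "Vector_Spaces.linear tscale tscale f" "\<And>vs. length vs = n \<Longrightarrow> f (P vs) \<in> TP m"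
  shows "f x \<in> TP m"
  using assms(1)
proof (induction rule: power_induct)
  case zero
  have "f (tscale 0 0) = tscale 0 (f 0)" using assms(2) unfolding linear_iff' by blast
  then show ?case by simp
next
  case (add c vs y)
  then show ?case using assms(2,3) by (auto simp: linear_iff' intro: add_in_power scale_in_power)
qed

lemma mult_add_left: "(x + y) \<odot> z = x \<odot> z + y \<odot> z"
  and mult_scale_left: "tscale c x \<odot> z = tscale c (x \<odot> z)"
  and mult_zero_left [simp]: "0 \<odot> z = 0"
  by (auto simp: tensor_mult_def lin_ext_def tscale_def fun_eq_iff plus_fun_apply zero_fun_apply)

text \<open>
  The product is defined by evaluating the left factor first.  For a pure left factor this evaluation
  goes through because the inner evaluation is again a multilinear form in the left argument; this is
  where membership of the right factor in the tensor algebra matters, since an arbitrary functional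
  need not respect multilinearity.
\<close>

lemma pure_mult:
  assumes "y \<in> TA"
  shows "P us \<odot> y = lin_ext (\<lambda>vs. P (us @ vs)) y"
proof
  fix f
  have "multilinear scale (*) (\<lambda>us. y (\<lambda>vs. P (us @ vs) f))"
    using assms
  proof (induction rule: algebra_induct)
    case zero
    then show ?case by (simp add: multilinear_zero vector_space_scale vector_space_mult zero_fun_apply)
  next
    case (add c vs y)
    have "multilinear scale (*) (\<lambda>us. P (us @ vs) f)"
      by (cases "multilinear scale (*) f")
        (auto simp: multilinear_def pure_tensor_def linear_iff' vector_space_scale vector_space_mult)
    moreover have "P vs (\<lambda>vs. P (us @ vs) f) = P (us @ vs) f" for us
      by (cases "multilinear scale (*) f")
        (auto simp: multilinear_def pure_tensor_def linear_iff' vector_space_scale vector_space_mult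
          simp flip: append_assoc)
    ultimately show ?case
      using add by (auto simp: tscale_def plus_fun_apply intro!: multilinear_add multilinear_scale)
  qed
  then show "(P us \<odot> y) f = lin_ext (\<lambda>vs. P (us @ vs)) y f"
    by (simp add: tensor_mult_def lin_ext_def pure_tensor_def)
qed

lemma pure_mult_pure [simp]: "P us \<odot> P vs = P (us @ vs)"
  by (rule tensor_mult_pure_tensor[OF vector_space_scale])

lemma mult_add_right:
  assumes "x \<in> TA" "y \<in> TA" "z \<in> TA"
  shows "x \<odot> (y + z) = x \<odot> y + x \<odot> z"
  using assms(1)
proof (induction rule: algebra_induct)
  case (add c vs x)
  then show ?case
    using assms by (simp add: mult_add_left mult_scale_left pure_mult add_in_algebra lin_ext_def)
      (auto simp: fun_eq_iff tscale_def plus_fun_apply algebra_simps)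
qed simp

lemma mult_scale_right:
  assumes "x \<in> TA" "y \<in> TA"
  shows "x \<odot> tscale c y = tscale c (x \<odot> y)"
  using assms(1)
proof (induction rule: algebra_induct)
  case (add c vs x)
  then show ?case
    using assms by (simp add: mult_add_left mult_scale_left pure_mult scale_in_algebra lin_ext_def)
      (auto simp: fun_eq_iff tscale_def plus_fun_apply algebra_simps)
qed simp

lemma mult_zero_right: "x \<in> TA \<Longrightarrow> x \<odot> 0 = 0"
  using mult_scale_right[of x 0 0] by simp

lemma mult_in_power:
  assumes "x \<in> TP m" "y \<in> TP n"
  shows "x \<odot> y \<in> TP (m + n)"
  using assms(1)
proof (induction rule: power_induct)
  case (add c us x)
  have "P us \<odot> y \<in> TP (m + n)"
    using assms(2)
  proof (induction rule: power_induct)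
    case (add c vs y)
    then show ?case
      using \<open>length us = m\<close>
      by (auto simp: mult_add_right mult_scale_right scale_in_algebra power_in_algebra intro!: add_in_power scale_in_power)
  qed (simp add: mult_zero_right)
  with add show ?case
    by (auto simp: mult_add_left mult_scale_left intro!: add_in_power scale_in_power)
qed simp

lemma linear_between_mult_left: "y \<in> TP n \<Longrightarrow> linear_between (TP m) (TP (m + n)) (\<lambda>x. x \<odot> y)"
  by (auto simp: linear_between_def mult_in_power mult_add_left mult_scale_left)

lemma linear_between_mult_right: "x \<in> TP m \<Longrightarrow> linear_between (TP n) (TP (m + n)) (\<lambda>y. x \<odot> y)"
  by (auto simp: linear_between_def mult_in_power mult_add_right mult_scale_right power_in_algebra)

lemma mult_in_algebra [simp]:
  assumes "x \<in> TA" "y \<in> TA"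
  shows "x \<odot> y \<in> TA"
  using assms(1)
proof (induction rule: algebra_induct)
  case (add c us x)
  have "P us \<odot> y \<in> TA"
    using assms(2)
    by (induction rule: algebra_induct)
      (auto simp: mult_zero_right mult_add_right mult_scale_right scale_in_algebra intro: add_in_algebra)
  with add show ?case
    by (simp add: mult_add_left mult_scale_left add_in_algebra scale_in_algebra)
qed simp

lemma mult_assoc:
  assumes "x \<in> TA" "y \<in> TA" "z \<in> TA"
  shows "(x \<odot> y) \<odot> z = x \<odot> y \<odot> z"
proof -
  have pure: "(P us \<odot> P vs) \<odot> z = P us \<odot> P vs \<odot> z" for us vs
    using assms(3)
    by (induction rule: algebra_induct)
      (simp_all del: pure_mult_pure add: mult_zero_right mult_add_right mult_scale_right scale_in_algebra,
       simp add: scale_in_algebra)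
  have left: "(P us \<odot> y) \<odot> z = P us \<odot> y \<odot> z" for us
    using assms(2)
    by (induction rule: algebra_induct)
      (simp_all del: pure_mult_pure add: mult_zero_right mult_add_left mult_scale_left mult_add_right
        mult_scale_right scale_in_algebra assms(3) pure)
  show ?thesis
    using assms(1)
    by (induction rule: algebra_induct)
      (simp_all add: mult_add_left mult_scale_left left)
qed

lemma unit_mult [simp]: "x \<in> TA \<Longrightarrow> P [] \<odot> x = x"
  and mult_unit [simp]: "x \<in> TA \<Longrightarrow> x \<odot> P [] = x"
  by (induction rule: algebra_induct;
      simp add: mult_zero_right mult_add_left mult_add_right mult_scale_left mult_scale_right scale_in_algebra)+

lemma linear_between_id: "linear_between A A id"
  by (auto simp: linear_between_def)


section \<open>Operators acting on a block of tensor factors\<close>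

lemma linear_in_argument:
  assumes "linear_between (TP n) B \<phi>" "length us + 1 + length vs = n"
  shows "Vector_Spaces.linear scale tscale (\<lambda>v. \<phi> (P (us @ v # vs)))"
proof -
  have "P (us @ (x + y) # vs) = P (us @ x # vs) + P (us @ y # vs)"
       "P (us @ scale c x # vs) = tscale c (P (us @ x # vs))" for c x y
    using multilinear_pure_tensor[OF vector_space_scale]
    unfolding multilinear_def linear_iff' by blast+
  then show ?thesis
    using assms by (simp add: linear_iff' vector_space_scale vector_space_tscale linear_betweenD[OF assms(1)])
qed

text \<open>
  Multilinearity of a function on lists is tested on lists of one fixed length at a time.  Hence a
  family of linear maps, one on each tensor power, glues to a single map on the tensor algebra.
\<close>

lemma lin_ext_graded:
  assumes E: "\<And>n. linear_between (TP n) TA (E n)" and g: "\<And>vs. g vs = E (length vs) (P vs)"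
    and x: "x \<in> TP n"
  shows "lin_ext g x = E n x"
proof (rule linear_eq_on_power[OF x linear_between_linearI[OF linear_lin_ext, of _ g UNIV] E])
  have "multilinear scale tscale g"
    unfolding multilinear_def
  proof (intro allI)
    fix us vs :: "'v list"
    have "(\<lambda>v. g (us @ v # vs)) = (\<lambda>v. E (length us + 1 + length vs) (P (us @ v # vs)))"
      by (simp add: g)
    then show "Vector_Spaces.linear scale tscale (\<lambda>v. g (us @ v # vs))"
      using linear_in_argument[OF E] by simp
  qed
  moreover have "g vs \<in> TA" for vs
    unfolding g by (rule linear_betweenD(1)[OF E]) simp
  ultimately have "lin_ext g (P vs) = g vs" for vs
    by (rule lin_ext_pure_tensor)
  then show "lin_ext g (P vs) = E n (P vs)" if "length vs = n" for vs
    using g that by simp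
qed simp

text \<open>
  The universal description of \<open>\<phi> \<otimes> \<psi>\<close>, in a form that applies to arbitrary elements of the two tensor
  powers and so survives composition of operators.  The underlying function of lists is multilinear
  because an argument lies either in the part seen by \<open>\<phi>\<close> or in the part seen by \<open>\<psi>\<close>.
\<close>

lemma map_tensor_mult:
  assumes \<phi>: "linear_between (TP l) (TP r) \<phi>" and \<psi>: "linear_between (TP m) (TP s) \<psi>"
    and x: "x \<in> TP l" and y: "y \<in> TP m"
  shows "map_tensor scale l m \<phi> \<psi> (x \<odot> y) = \<phi> x \<odot> \<psi> y"
proof -
  define g where "g = (\<lambda>vs. if length vs = l + m then \<phi> (P (take l vs)) \<odot> \<psi> (P (drop l vs)) else 0)"
  have map: "map_tensor scale l m \<phi> \<psi> = lin_ext g"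
    by (simp add: map_tensor_def g_def)
  have multilinear: "multilinear scale tscale g"
    unfolding multilinear_def
  proof (intro allI)
    fix us vs :: "'v list"
    consider "length us + 1 + length vs \<noteq> l + m"
      | "length us + 1 + length vs = l + m" "length us < l"
      | "length us + 1 + length vs = l + m" "l \<le> length us"
      by linarith
    then show "Vector_Spaces.linear scale tscale (\<lambda>v. g (us @ v # vs))"
    proof cases
      case 1
      then show ?thesis
        by (simp add: g_def linear_iff' vector_space_scale vector_space_tscale)
    next
      case 2
      then obtain d where d: "l = length us + Suc d"
        using less_imp_Suc_add by fastforce
      let ?y = "\<psi> (P (drop d vs))"
      have y: "?y \<in> TP s"
        using 2 d by (intro linear_betweenD[OF \<psi>] pure_in_power) simp
      have "(\<lambda>v. g (us @ v # vs)) = (\<lambda>v. \<phi> (P (us @ v # take d vs)) \<odot> ?y)"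
        using 2 by (simp add: g_def d)
      then show ?thesis
        using linear_in_argument[OF linear_between_comp[OF \<phi> linear_between_mult_left[OF y]], of us "take d vs"] 2 d
        by simp
    next
      case 3
      have x: "\<phi> (P (take l us)) \<in> TP r"
        using 3 by (intro linear_betweenD[OF \<phi>] pure_in_power) simp
      have "(\<lambda>v. g (us @ v # vs)) = (\<lambda>v. \<phi> (P (take l us)) \<odot> \<psi> (P (drop l us @ v # vs)))"
        using 3 by (simp add: g_def)
      then show ?thesis
        using linear_in_argument[OF linear_between_comp[OF \<psi> linear_between_mult_right[OF x]], of "drop l us" vs] 3
        by simp
    qed
  qed
  have in_algebra: "g vs \<in> TA" for vs
    by (simp add: g_def power_in_algebra[OF linear_betweenD(1)[OF \<phi>]] power_in_algebra[OF linear_betweenD(1)[OF \<psi>]])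
  have lin: "Vector_Spaces.linear tscale tscale (map_tensor scale l m \<phi> \<psi>)"
    unfolding map by (rule linear_lin_ext)
  have pure: "map_tensor scale l m \<phi> \<psi> (P us \<odot> P vs) = \<phi> (P us) \<odot> \<psi> (P vs)"
    if "length us = l" "length vs = m" for us vs
    using that lin_ext_pure_tensor[OF multilinear in_algebra, of "us @ vs"] by (simp add: map g_def)
  have lin': "linear_between (TP (l + m)) UNIV (map_tensor scale l m \<phi> \<psi>)"
    by (rule linear_between_linearI[OF lin]) simp
  show ?thesis
  proof (rule linear_eq_on_power[OF x linear_between_comp[OF linear_between_mult_left[OF y] lin']
        linear_between_comp[OF \<phi> linear_between_mult_left[OF linear_betweenD(1)[OF \<psi> y]]]])
    fix us :: "'v list" assume us: "length us = l"
    then have us': "P us \<in> TP l" by simp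
    show "map_tensor scale l m \<phi> \<psi> (P us \<odot> y) = \<phi> (P us) \<odot> \<psi> y"
      by (rule linear_eq_on_power[OF y linear_between_comp[OF linear_between_mult_right[OF us'] lin']
            linear_between_comp[OF \<psi> linear_between_mult_right[OF linear_betweenD(1)[OF \<phi> us']]]])
        (rule pure[OF us])
  qed
qed

lemma pure_split:
  assumes "length vs = a + b"
  obtains us ws where "P vs = P us \<odot> P ws" "length us = a" "length ws = b"
  by (rule that[of "take a vs" "drop a vs"]) (use assms in auto)

lemma map_tensor_linear_between:
  assumes "linear_between (TP l) (TP r) \<phi>" "linear_between (TP m) (TP s) \<psi>"
  shows "linear_between (TP (l + m)) (TP (r + s)) (map_tensor scale l m \<phi> \<psi>)"
proof (rule linear_between_linearI)
  show lin: "Vector_Spaces.linear tscale tscale (map_tensor scale l m \<phi> \<psi>)"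
    unfolding map_tensor_def by (rule linear_lin_ext)
  show "map_tensor scale l m \<phi> \<psi> x \<in> TP (r + s)" if "x \<in> TP (l + m)" for x
  proof (rule power_mem_on_generators[OF that lin])
    fix vs :: "'v list" assume "length vs = l + m"
    then obtain us ws where vs: "P vs = P us \<odot> P ws" and len: "length us = l" "length ws = m"
      by (rule pure_split)
    have pure: "P us \<in> TP l" "P ws \<in> TP m"
      using len by simp_all
    show "map_tensor scale l m \<phi> \<psi> (P vs) \<in> TP (r + s)"
      unfolding vs map_tensor_mult[OF assms pure]
      by (rule mult_in_power[OF linear_betweenD(1)[OF assms(1) pure(1)] linear_betweenD(1)[OF assms(2) pure(2)]])
  qed
qed

lemma act_at_eq_map_tensor:
  assumes "n = a + l + b" "i = Suc a"
  shows "act_at scale n l \<phi> i = map_tensor scale a (l + b) id (map_tensor scale l b \<phi> id)"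
  using assms by (simp add: act_at_def)

lemma act_at_mult:
  assumes \<phi>: "linear_between (TP l) (TP r) \<phi>"
    and x: "x \<in> TP a" and y: "y \<in> TP l" and z: "z \<in> TP b" and num: "n = a + l + b" "i = Suc a"
  shows "act_at scale n l \<phi> i (x \<odot> y \<odot> z) = x \<odot> \<phi> y \<odot> z"
  unfolding act_at_eq_map_tensor[OF num] map_tensor_mult[OF linear_between_id
      map_tensor_linear_between[OF \<phi> linear_between_id] x mult_in_power[OF y z]]
    map_tensor_mult[OF \<phi> linear_between_id y z] id_apply ..

lemma act_at_linear_between:
  assumes \<phi>: "linear_between (TP l) (TP r) \<phi>" and num: "n = a + l + b" "i = Suc a" and m: "m = a + r + b"
  shows "linear_between (TP n) (TP m) (act_at scale n l \<phi> i)"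
  unfolding act_at_eq_map_tensor[OF num] unfolding num(1) m add.assoc
  by (intro map_tensor_linear_between linear_between_id \<phi>)

text \<open>
  \<open>V\<^sup>\<otimes>\<^sup>n\<close> is spanned by products from \<open>V\<^sup>\<otimes>\<^sup>a\<close>, \<open>V\<^sup>\<otimes>\<^sup>b\<close> and \<open>V\<^sup>\<otimes>\<^sup>c\<close>.  Splitting with the middle block being the
  one an operator acts on reduces identities between operators to identities in low degree.
\<close>

lemma power_split3_eqI:
  assumes "linear_between (TP n) B f" "linear_between (TP n) C g" "x \<in> TP n" "n = a + b + c"
    and eq: "\<And>u v w. u \<in> TP a \<Longrightarrow> v \<in> TP b \<Longrightarrow> w \<in> TP c \<Longrightarrow> f (u \<odot> v \<odot> w) = g (u \<odot> v \<odot> w)"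
  shows "f x = g x"
proof (rule linear_eq_on_power[OF assms(3,1,2)])
  fix vs :: "'v list" assume len: "length vs = n"
  have "P vs = P (take a vs) \<odot> P (take b (drop a vs)) \<odot> P (drop b (drop a vs))"
    by (simp only: pure_mult_pure append_take_drop_id)
  moreover have "f \<dots> = g \<dots>"
    by (rule eq) (use len assms(4) in auto)
  ultimately show "f (P vs) = g (P vs)" by simp
qed

text \<open>
  Factors outside a block can be stripped off: this transports the relations of \<open>\<sigma>\<close>, which are given in
  degrees 2 and 3, to any position in any degree.
\<close>

lemma act_at_pad:
  assumes \<phi>: "linear_between (TP l) (TP r) \<phi>"
    and xyz: "x \<in> TP a" "y \<in> TP m" "z \<in> TP b"
    and num: "m = c + l + d" "n = a + m + b" "i = a + j" "j = Suc c"
  shows "act_at scale n l \<phi> i (x \<odot> y \<odot> z) = x \<odot> act_at scale m l \<phi> j y \<odot> z"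
proof (rule power_split3_eqI[OF _ _ xyz(2) num(1)])
  have outer: "linear_between (TP n) (TP (a + c + r + (d + b))) (act_at scale n l \<phi> i)"
    by (rule act_at_linear_between[OF \<phi>, where a = "a + c" and b = "d + b"]) (use num in auto)
  have inner: "linear_between (TP m) (TP (c + r + d)) (act_at scale m l \<phi> j)"
    by (rule act_at_linear_between[OF \<phi>, where a = c and b = d]) (use num in auto)
  have pad: "linear_between (TP k) (TP (a + (k + b))) (\<lambda>y. x \<odot> y \<odot> z)" for k
    by (rule linear_between_comp[OF linear_between_mult_left[OF xyz(3)] linear_between_mult_right[OF xyz(1)]])
  show "linear_between (TP m) (TP (a + c + r + (d + b))) (\<lambda>y. act_at scale n l \<phi> i (x \<odot> y \<odot> z))"
    by (rule linear_between_comp[OF _ outer]) (use pad[of m] num(2) in \<open>simp add: add.assoc\<close>)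
  show "linear_between (TP m) (TP (a + (c + r + d + b))) (\<lambda>y. x \<odot> act_at scale m l \<phi> j y \<odot> z)"
    by (rule linear_between_comp[OF inner pad])
  fix u v w assume uvw: "u \<in> TP c" "v \<in> TP l" "w \<in> TP d"
  note in_algebra = xyz[THEN power_in_algebra] uvw[THEN power_in_algebra]
    linear_betweenD(1)[OF \<phi> uvw(2), THEN power_in_algebra]
  have "act_at scale n l \<phi> i (x \<odot> (u \<odot> v \<odot> w) \<odot> z) = act_at scale n l \<phi> i ((x \<odot> u) \<odot> v \<odot> (w \<odot> z))"
    by (simp add: mult_assoc in_algebra)
  also have "\<dots> = (x \<odot> u) \<odot> \<phi> v \<odot> (w \<odot> z)"
    by (rule act_at_mult[OF \<phi> mult_in_power[OF xyz(1) uvw(1)] uvw(2) mult_in_power[OF uvw(3) xyz(3)]])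
      (use num in auto)
  also have "\<dots> = x \<odot> (u \<odot> \<phi> v \<odot> w) \<odot> z"
    by (simp add: mult_assoc in_algebra)
  also have "u \<odot> \<phi> v \<odot> w = act_at scale m l \<phi> j (u \<odot> v \<odot> w)"
    by (rule act_at_mult[OF \<phi> uvw, symmetric]) (use num in auto)
  finally show "act_at scale n l \<phi> i (x \<odot> (u \<odot> v \<odot> w) \<odot> z) = x \<odot> act_at scale m l \<phi> j (u \<odot> v \<odot> w) \<odot> z" .
qed

lemma act_at_pad_left:
  assumes "linear_between (TP l) (TP r) \<phi>" "x \<in> TP a" "y \<in> TP m"
    and "m = c + l + d" "n = a + m" "i = a + j" "j = Suc c"
  shows "act_at scale n l \<phi> i (x \<odot> y) = x \<odot> act_at scale m l \<phi> j y"
proof -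
  have "act_at scale m l \<phi> j y \<in> TP (c + r + d)"
    by (rule linear_betweenD(1)[OF act_at_linear_between[OF assms(1)] assms(3)]) (use assms in auto)
  then show ?thesis
    using act_at_pad[OF assms(1-3), of "P []" 0 c d n i j] assms by (simp add: power_in_algebra)
qed

lemma act_at_pad_right:
  assumes "linear_between (TP l) (TP r) \<phi>" "y \<in> TP m" "z \<in> TP b"
    and "m = c + l + d" "n = m + b" "j = Suc c"
  shows "act_at scale n l \<phi> j (y \<odot> z) = act_at scale m l \<phi> j y \<odot> z"
proof -
  have "act_at scale m l \<phi> j y \<in> TP (c + r + d)"
    by (rule linear_betweenD(1)[OF act_at_linear_between[OF assms(1)] assms(2)]) (use assms in auto)
  then show ?thesis
    using act_at_pad[OF assms(1) _ assms(2,3), of "P []" 0 c d n j j] assms by (simp add: power_in_algebra)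
qed

text \<open>
  Operators on disjoint blocks commute.  The degrees \<open>l \<rightarrow> r\<close> of the left operator need not agree, so the
  right block starts at a position shifted by \<open>r - l\<close> after the left operator has acted.  This single law
  covers the far commutativity of the braid generators, the passage of a linear form past a braid
  generator, and the commutation of two linear forms applied at the two ends.
\<close>

lemma act_at_interchange:
  assumes \<phi>: "linear_between (TP l) (TP r) \<phi>" and \<psi>: "linear_between (TP m) (TP s) \<psi>"
    and x: "x \<in> TP n" and num: "n = a + l + b + m + c"
    and idx: "i = Suc a" "j = Suc (a + l + b)" "j' = Suc (a + r + b)"
    and deg: "n1 = a + r + b + m + c" "n2 = a + l + b + s + c"
  shows "act_at scale n1 m \<psi> j' (act_at scale n l \<phi> i x) = act_at scale n2 l \<phi> i (act_at scale n m \<psi> j x)"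
proof (rule linear_eq_on_power[OF x])
  let ?N = "a + r + b + s + c"
  have "linear_between (TP n) (TP n1) (act_at scale n l \<phi> i)"
    by (rule act_at_linear_between[OF \<phi>, where a = a and b = "b + m + c"]) (use num idx deg in auto)
  moreover have "linear_between (TP n1) (TP ?N) (act_at scale n1 m \<psi> j')"
    by (rule act_at_linear_between[OF \<psi>, where a = "a + r + b" and b = c]) (use num idx deg in auto)
  ultimately show "linear_between (TP n) (TP ?N) (\<lambda>x. act_at scale n1 m \<psi> j' (act_at scale n l \<phi> i x))"
    by (rule linear_between_comp)
  have "linear_between (TP n) (TP n2) (act_at scale n m \<psi> j)"
    by (rule act_at_linear_between[OF \<psi>, where a = "a + l + b" and b = c]) (use num idx deg in auto)
  moreover have "linear_between (TP n2) (TP ?N) (act_at scale n2 l \<phi> i)"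
    by (rule act_at_linear_between[OF \<phi>, where a = a and b = "b + s + c"]) (use num idx deg in auto)
  ultimately show "linear_between (TP n) (TP ?N) (\<lambda>x. act_at scale n2 l \<phi> i (act_at scale n m \<psi> j x))"
    by (rule linear_between_comp)
  fix vs :: "'v list" assume len: "length vs = n"
  define p q v p' q' where "p = P (take a vs)" and "q = P (take l (drop a vs))"
    and "v = P (take b (drop (a + l) vs))" and "p' = P (take m (drop (a + l + b) vs))"
    and "q' = P (drop (a + l + b + m) vs)"
  note defs = this
  have pq: "p \<in> TP a" "q \<in> TP l" "v \<in> TP b" "p' \<in> TP m" "q' \<in> TP c"
    using len num by (auto simp: defs)
  have "take a vs @ take l (drop a vs) @ take b (drop (a + l) vs) @ take m (drop (a + l + b) vs)
      @ drop (a + l + b + m) vs = vs"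
    by (metis append_take_drop_id drop_drop add.commute)
  then have vs: "P vs = p \<odot> q \<odot> v \<odot> p' \<odot> q'"
    by (simp add: defs)
  have n12: "n = a + l + (b + (m + c))" and n12': "n = a + (l + b) + m + c" and idx2: "j = Suc (a + (l + b))"
    using num idx by simp_all
  have im: "\<phi> q \<in> TP r" "\<psi> p' \<in> TP s"
    by (rule linear_betweenD(1)[OF \<phi> pq(2)], rule linear_betweenD(1)[OF \<psi> pq(4)])
  note in_algebra = pq[THEN power_in_algebra] im[THEN power_in_algebra]
  have 1: "act_at scale n l \<phi> i (P vs) = (p \<odot> \<phi> q \<odot> v) \<odot> p' \<odot> q'"
    unfolding vs act_at_mult[OF \<phi> pq(1,2) mult_in_power[OF pq(3) mult_in_power[OF pq(4,5)]] n12 idx(1)]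
    by (simp add: mult_assoc in_algebra)
  have 2: "act_at scale n1 m \<psi> j' ((p \<odot> \<phi> q \<odot> v) \<odot> p' \<odot> q') = (p \<odot> \<phi> q \<odot> v) \<odot> \<psi> p' \<odot> q'"
    by (rule act_at_mult[OF \<psi> mult_in_power[OF pq(1) mult_in_power[OF im(1) pq(3)]] pq(4,5)])
      (use num idx deg in auto)
  have vs': "P vs = (p \<odot> q \<odot> v) \<odot> p' \<odot> q'"
    by (simp add: mult_assoc in_algebra vs)
  have 3: "act_at scale n m \<psi> j (P vs) = p \<odot> q \<odot> (v \<odot> \<psi> p' \<odot> q')"
    unfolding vs' act_at_mult[OF \<psi> mult_in_power[OF pq(1) mult_in_power[OF pq(2,3)]] pq(4,5) n12' idx2]
    by (simp add: mult_assoc in_algebra)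
  have 4: "act_at scale n2 l \<phi> i (p \<odot> q \<odot> (v \<odot> \<psi> p' \<odot> q')) = p \<odot> \<phi> q \<odot> (v \<odot> \<psi> p' \<odot> q')"
    by (rule act_at_mult[OF \<phi> pq(1,2) mult_in_power[OF pq(3) mult_in_power[OF im(2) pq(5)]]])
      (use num idx deg in auto)
  show "act_at scale n1 m \<psi> j' (act_at scale n l \<phi> i (P vs)) =
      act_at scale n2 l \<phi> i (act_at scale n m \<psi> j (P vs))"
    unfolding 1 2 3 4 by (simp add: mult_assoc in_algebra)
qed

lemma linear_between_sum:
  assumes "\<And>i. i \<in> I \<Longrightarrow> linear_between (TP n) (TP m) (f i)"
  shows "linear_between (TP n) (TP m) (\<lambda>x. \<Sum>i\<in>I. tscale (c i) (f i x))"
proof -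
  have "tscale (c i) (f i (x + y)) = tscale (c i) (f i x) + tscale (c i) (f i y)"
    if "i \<in> I" "x \<in> TP n" "y \<in> TP n" for i x y
    using linear_betweenD(2)[OF assms] that by (simp add: T.scale_right_distrib)
  moreover have "tscale (c i) (f i (tscale d x)) = tscale d (tscale (c i) (f i x))"
    if "i \<in> I" "x \<in> TP n" for i x d
    using linear_betweenD(3)[OF assms] that by (simp add: mult.commute)
  moreover have "tscale (c i) (f i x) \<in> TP m" if "i \<in> I" "x \<in> TP n" for i x
    using linear_betweenD(1)[OF assms] that by (simp add: scale_in_power)
  ultimately show ?thesis
    unfolding linear_between_def image_subset_iff
    by (simp add: sum_in_power sum.distrib[symmetric] T.scale_sum_right)
qed

lemma linear_between_of_sum:
  assumes f: "linear_between (TP n) B f" and g: "\<And>i. i \<in> I \<Longrightarrow> g i \<in> TP n"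
  shows "f (\<Sum>i\<in>I. tscale (c i) (g i)) = (\<Sum>i\<in>I. tscale (c i) (f (g i)))"
  using g
proof (induction I rule: infinite_finite_induct)
  case (insert i I)
  then have mem: "g i \<in> TP n" "(\<Sum>i\<in>I. tscale (c i) (g i)) \<in> TP n"
    by (auto intro!: sum_in_power scale_in_power)
  then show ?case
    using insert by (simp add: linear_betweenD(2)[OF f scale_in_power] linear_betweenD(3)[OF f])
qed (simp_all add: linear_between_zero[OF f])


section \<open>Linear forms applied to tensor factors\<close>

lemma form_map_pure:
  assumes f: "Vector_Spaces.linear scale (*) f"
  shows "form_map scale f (P [v]) = tscale (f v) (P [])"
proof -
  have "multilinear scale tscale (\<lambda>vs. if length vs = 1 then tscale (f (hd vs)) (P []) else 0)"
    unfolding multilinear_def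
  proof (intro allI)
    fix us vs :: "'v list"
    show "Vector_Spaces.linear scale tscale
        (\<lambda>v. if length (us @ v # vs) = 1 then tscale (f (hd (us @ v # vs))) (P []) else 0)"
      using f by (auto simp: linear_iff' vector_space_tscale T.scale_left_distrib)
  qed
  from lin_ext_pure_tensor[OF this] show ?thesis
    by (simp add: form_map_def scale_in_algebra)
qed

lemma form_map_linear_between:
  assumes f: "Vector_Spaces.linear scale (*) f"
  shows "linear_between (TP 1) (TP 0) (form_map scale f)"
proof (rule linear_between_linearI)
  show lin: "Vector_Spaces.linear tscale tscale (form_map scale f)"
    unfolding form_map_def by (rule linear_lin_ext)
  fix x assume "x \<in> TP 1"
  then show "form_map scale f x \<in> TP 0"
  proof (rule power_mem_on_generators[OF _ lin])
    fix vs :: "'v list" assume "length vs = 1"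
    then show "form_map scale f (P vs) \<in> TP 0"
      by (auto simp: length_Suc_conv form_map_pure[OF f] scale_in_power)
  qed
qed

lemma act_at_first:
  assumes "linear_between (TP l) (TP r) \<phi>" "x \<in> TP l" "y \<in> TP b" "n = l + b"
  shows "act_at scale n l \<phi> 1 (x \<odot> y) = \<phi> x \<odot> y"
proof -
  have "\<phi> x \<odot> y \<in> TA" "x \<odot> y \<in> TA"
    by (rule power_in_algebra[OF mult_in_power[OF linear_betweenD(1)[OF assms(1,2)] assms(3)]],
        rule power_in_algebra[OF mult_in_power[OF assms(2,3)]])
  then show ?thesis
    using act_at_mult[OF assms(1), of "P []" 0 x y b n 1] assms by simp
qed

lemma act_at_last:
  assumes "linear_between (TP l) (TP r) \<phi>" "x \<in> TP a" "y \<in> TP l" "n = a + l" "i = Suc a"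
  shows "act_at scale n l \<phi> i (x \<odot> y) = x \<odot> \<phi> y"
proof -
  have "\<phi> y \<in> TA" "y \<in> TA"
    by (rule power_in_algebra[OF linear_betweenD(1)[OF assms(1,3)]], rule power_in_algebra[OF assms(3)])
  then show ?thesis
    using act_at_mult[OF assms(1-3), of "P []" 0 n i] assms by simp
qed

lemma form_at_first_pure:
  assumes f: "Vector_Spaces.linear scale (*) f" and "length vs = n"
  shows "act_at scale (Suc n) 1 (form_map scale f) 1 (P (v # vs)) = tscale (f v) (P vs)"
  using act_at_first[OF form_map_linear_between[OF f], of "P [v]" "P vs" n "Suc n"] assms(2)
  by (simp add: form_map_pure[OF f] mult_scale_left)

lemma form2_mult:
  assumes f: "Vector_Spaces.linear scale (*) f" and g: "Vector_Spaces.linear scale (*) g"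
    and "x \<in> TP 1" "y \<in> TP 1"
  shows "form2 scale f g (x \<odot> y) = form_map scale f x \<odot> form_map scale g y"
  unfolding form2_def
  by (rule map_tensor_mult[OF form_map_linear_between[OF f] form_map_linear_between[OF g] assms(3,4)])

lemma form2_linear_between:
  assumes f: "Vector_Spaces.linear scale (*) f" and g: "Vector_Spaces.linear scale (*) g"
  shows "linear_between (TP 2) (TP 0) (form2 scale f g)"
  using map_tensor_linear_between[OF form_map_linear_between[OF f] form_map_linear_between[OF g]]
  unfolding form2_def by (simp add: numeral_2_eq_2)

lemma form2_pure:
  assumes f: "Vector_Spaces.linear scale (*) f" and g: "Vector_Spaces.linear scale (*) g"
  shows "form2 scale f g (P [a, b]) = tscale (f a * g b) (P [])"
  using form2_mult[OF f g, of "P [a]" "P [b]"]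
  by (simp add: form_map_pure f g mult_scale_left mult_scale_right scale_in_algebra)

text \<open>
  Applying first \<open>f\<close> and then \<open>g\<close> to the leading factor consumes the first two factors, in this order.
  Compatibility with \<open>\<sigma>\<close> is a condition on such forms of two arguments.
\<close>

lemma forms_at_first:
  assumes f: "Vector_Spaces.linear scale (*) f" and g: "Vector_Spaces.linear scale (*) g"
    and x: "x \<in> TP (Suc (Suc n))"
  shows "act_at scale (Suc n) 1 (form_map scale g) 1 (act_at scale (Suc (Suc n)) 1 (form_map scale f) 1 x) =
    act_at scale (Suc (Suc n)) 2 (form2 scale f g) 1 x"
proof (rule linear_eq_on_power[OF x])
  have at: "linear_between (TP (Suc m)) (TP m) (act_at scale (Suc m) 1 (form_map scale h) 1)"
    if h: "Vector_Spaces.linear scale (*) h" for h m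
    by (rule act_at_linear_between[OF form_map_linear_between[OF h], where a = 0 and b = m]) auto
  show "linear_between (TP (Suc (Suc n))) (TP n)
      (\<lambda>x. act_at scale (Suc n) 1 (form_map scale g) 1 (act_at scale (Suc (Suc n)) 1 (form_map scale f) 1 x))"
    by (rule linear_between_comp[OF at[OF f] at[OF g]])
  show "linear_between (TP (Suc (Suc n))) (TP n) (act_at scale (Suc (Suc n)) 2 (form2 scale f g) 1)"
    by (rule act_at_linear_between[OF form2_linear_between[OF f g], where a = 0 and b = n]) auto
  fix vs :: "'v list" assume "length vs = Suc (Suc n)"
  then obtain a b us where vs: "vs = a # b # us" and us: "length us = n"
    by (auto simp: length_Suc_conv)
  have mem: "P (b # us) \<in> TP (Suc n)" using us by simp
  have "act_at scale (Suc (Suc n)) 2 (form2 scale f g) 1 (P vs) = tscale (f a * g b) (P us)"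
    using act_at_first[OF form2_linear_between[OF f g], of "P [a, b]" "P us" n "Suc (Suc n)"] us
    by (simp add: form2_pure[OF f g] mult_scale_left vs)
  then show "act_at scale (Suc n) 1 (form_map scale g) 1 (act_at scale (Suc (Suc n)) 1 (form_map scale f) 1 (P vs)) =
      act_at scale (Suc (Suc n)) 2 (form2 scale f g) 1 (P vs)"
    using us form_at_first_pure[OF f, of "b # us" "Suc n" a] form_at_first_pure[OF g us, of b]
      linear_betweenD(3)[OF at[OF g] mem, of "f a"]
    by (simp add: vs)
qed

text \<open>
  The quantum shuffles are taken for \<open>- \<sigma>\<close>, so each braid generator in them contributes a sign.
\<close>

lemma act_at_uminus:
  assumes \<phi>: "linear_between (TP l) (TP r) \<phi>" and x: "x \<in> TP n" and num: "n = a + l + b" "i = Suc a"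
  shows "act_at scale n l (- \<phi>) i x = tscale (- 1) (act_at scale n l \<phi> i x)"
proof (rule power_split3_eqI[OF _ _ x num(1)])
  have uminus: "(- \<phi>) y = tscale (- 1) (\<phi> y)" for y by (simp add: uminus_apply)
  have \<phi>': "linear_between (TP l) (TP r) (- \<phi>)"
    unfolding linear_between_def image_subset_iff uminus
    by (simp add: linear_betweenD[OF \<phi>] scale_in_power del: T.scale_minus_left)
      (simp add: mult.commute)
  show "linear_between (TP n) (TP (a + r + b)) (act_at scale n l (- \<phi>) i)"
    by (rule act_at_linear_between[OF \<phi>' num refl])
  have "linear_between (TP n) (TP (a + r + b)) (act_at scale n l \<phi> i)"
    by (rule act_at_linear_between[OF \<phi> num refl])
  from linear_between_sum[of "{()}", OF this, of "\<lambda>_. - 1"]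
  show "linear_between (TP n) (TP (a + r + b)) (\<lambda>x. tscale (- 1) (act_at scale n l \<phi> i x))"
    by simp
  fix u v w assume uvw: "u \<in> TP a" "v \<in> TP l" "w \<in> TP b"
  show "act_at scale n l (- \<phi>) i (u \<odot> v \<odot> w) = tscale (- 1) (act_at scale n l \<phi> i (u \<odot> v \<odot> w))"
    unfolding act_at_mult[OF \<phi> uvw num] act_at_mult[OF \<phi>' uvw num] uminus
    by (simp only: mult_scale_left mult_scale_right mult_in_algebra uvw[THEN power_in_algebra]
        power_in_algebra[OF linear_betweenD(1)[OF \<phi> uvw(2)]])
qed

end


section \<open>Shuffles moving a single letter\<close>

lemma word_perm_Nil [simp]: "word_perm [] = id"
  and word_perm_Cons [simp]: "word_perm (i # is) = Transposition.transpose i (i + 1) \<circ> word_perm is"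
  by (simp_all add: word_perm_def)

lemma word_perm_append [simp]: "word_perm (is @ js) = word_perm is \<circ> word_perm js"
  by (induction "is") (auto simp: comp_assoc)

lemma word_perm_permutes: "set is \<subseteq> {1..<n} \<Longrightarrow> word_perm is permutes {1..n}"
  by (induction "is") (auto intro!: permutes_compose permutes_swap_id permutes_id)

lemma inv_word_perm: "inv (word_perm is) = word_perm (rev is)"
proof (rule inv_unique_comp)
  show "word_perm is \<circ> word_perm (rev is) = id" for "is"
    by (induction "is") (simp_all add: fun_eq_iff)
  from this[of "rev is"] show "word_perm (rev is) \<circ> word_perm is = id" by simp
qed

lemma word_perm_upt:
  "j \<le> k \<Longrightarrow> word_perm [j..<k] x = (if x = k then j else if j \<le> x \<and> x < k then x + 1 else x)"
  by (induction k arbitrary: x) (auto simp: Transposition.transpose_def le_Suc_eq)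

lemma word_perm_rev_upt:
  "j \<le> k \<Longrightarrow> word_perm (rev [j..<k]) x = (if x = j then k else if j < x \<and> x \<le> k then x - 1 else x)"
  by (induction k arbitrary: x) (auto simp: Transposition.transpose_def le_Suc_eq)

text \<open>
  An adjacent transposition moves a number by at most 1.  So a word taking \<open>k\<close> to \<open>j\<close> has at least \<open>k - j\<close>
  letters, and in the case of equality every letter has to bring the number one step closer to \<open>j\<close>,
  which determines the word.
\<close>

lemma word_moving_down:
  assumes "word_perm is k = j"
  shows "k \<le> j + length is \<and> (k = j + length is \<longrightarrow> is = [j..<k])"
  using assms
proof (induction "is" arbitrary: j)
  case (Cons i "is")
  define p where "p = word_perm is k"
  have j: "j = Transposition.transpose i (i + 1) p"
    using Cons.prems by (simp add: p_def)
  have IH: "k \<le> p + length is" "k = p + length is \<Longrightarrow> is = [p..<k]"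
    using Cons.IH[OF p_def[symmetric]] by auto
  show ?case
  proof (intro conjI impI)
    show "k \<le> j + length (i # is)"
      using j IH(1) by (auto simp: Transposition.transpose_def split: if_splits)
    assume "k = j + length (i # is)"
    with j IH(1) have "p = j + 1" "i = j"
      by (auto simp: Transposition.transpose_def split: if_splits)
    with IH \<open>k = j + length (i # is)\<close> show "i # is = [j..<k]"
      by (simp add: upt_conv_Cons del: upt_Suc)
  qed
qed simp

lemma word_moving_up:
  assumes "word_perm is k = j"
  shows "j \<le> k + length is \<and> (j = k + length is \<longrightarrow> is = rev [k..<j])"
  using assms
proof (induction "is" arbitrary: j)
  case (Cons i "is")
  define p where "p = word_perm is k"
  have j: "j = Transposition.transpose i (i + 1) p"
    using Cons.prems by (simp add: p_def)
  have IH: "p \<le> k + length is" "p = k + length is \<Longrightarrow> is = rev [k..<p]"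
    using Cons.IH[OF p_def[symmetric]] by auto
  show ?case
  proof (intro conjI impI)
    show "j \<le> k + length (i # is)"
      using j IH(1) by (auto simp: Transposition.transpose_def split: if_splits)
    assume "j = k + length (i # is)"
    with j IH(1) have "j = Suc p" "i = p" "p = k + length is"
      by (auto simp: Transposition.transpose_def split: if_splits)
    with IH show "i # is = rev [k..<j]"
      by simp
  qed
qed simp

text \<open>
  A shortest word is in general unique only up to braid moves, and \<open>shortest_word\<close> picks an unspecified
  one.  For the shuffles that occur here the shortest word is unique, so the choice is known.
\<close>

lemma shortest_word_eqI:
  assumes w: "set w \<subseteq> {1..<n}" "word_perm w = s"
    and uniq: "\<And>is. word_perm is = s \<Longrightarrow> length is \<le> length w \<Longrightarrow> is = w"
  shows "shortest_word n s = w"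
proof -
  let ?Q = "\<lambda>is. set is \<subseteq> {1..<n} \<and> word_perm is = s"
  have "?Q (shortest_word n s) \<and> length (shortest_word n s) \<le> length w"
    using arg_min_nat_lemma[of ?Q w length] w unfolding shortest_word_def by simp
  then show ?thesis using uniq by blast
qed

lemma shortest_word_upt:
  assumes "1 \<le> j" "j \<le> k" "k \<le> n"
  shows "shortest_word n (word_perm [j..<k]) = [j..<k]"
proof (rule shortest_word_eqI)
  fix "is" assume eq: "word_perm is = word_perm [j..<k]" and "length is \<le> length [j..<k]"
  then have "length is \<le> k - j" by simp
  moreover have *: "k \<le> j + length is \<and> (k = j + length is \<longrightarrow> is = [j..<k])"
    by (rule word_moving_down) (use assms(2) in \<open>simp add: eq word_perm_upt\<close>)
  ultimately have "k = j + length is" using assms(2) by linarith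
  with * show "is = [j..<k]" by blast
qed (use assms in auto)

lemma shortest_word_rev_upt:
  assumes "1 \<le> j" "j \<le> k" "k \<le> n"
  shows "shortest_word n (word_perm (rev [j..<k])) = rev [j..<k]"
proof (rule shortest_word_eqI)
  fix "is" assume eq: "word_perm is = word_perm (rev [j..<k])" and "length is \<le> length (rev [j..<k])"
  then have "length is \<le> k - j" by simp
  moreover have *: "k \<le> j + length is \<and> (k = j + length is \<longrightarrow> is = rev [j..<k])"
    by (rule word_moving_up) (use assms(2) in \<open>simp add: eq word_perm_rev_upt\<close>)
  ultimately have "k = j + length is" using assms(2) by linarith
  with * show "is = rev [j..<k]" by blast
qed (use assms in auto)

lemma strict_mono_on_image_unique:
  fixes f g :: "'a::wellorder \<Rightarrow> 'b::linorder"
  assumes f: "strict_mono_on A f" and g: "strict_mono_on A g" and "f ` A = g ` A" and "a \<in> A"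
  shows "f a = g a"
  using \<open>a \<in> A\<close>
proof (induction a rule: less_induct)
  case (less a)
  have *: "\<not> f a < g a" if f: "strict_mono_on A f" and g: "strict_mono_on A g" and im: "f ` A = g ` A"
      and agree: "\<And>b. b < a \<Longrightarrow> b \<in> A \<Longrightarrow> f b = g b" for f g :: "'a \<Rightarrow> 'b"
  proof
    assume lt: "f a < g a"
    obtain b where b: "b \<in> A" "f a = g b" using im less.prems by (metis imageE imageI)
    show False
    proof (cases "b < a")
      case True
      with b agree[OF True b(1)] strict_mono_onD[OF f b(1) less.prems True] show ?thesis by simp
    next
      case False
      with b less.prems lt strict_mono_onD[OF g less.prems b(1)] show ?thesis
        by (cases a b rule: linorder_cases) auto
    qed
  qed
  show ?case
    using *[OF f g assms(3)] *[OF g f assms(3)[symmetric]] less.IH by force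
qed

text \<open>
  A permutation that is increasing on \<open>A\<close> is determined by its values outside \<open>A\<close>: these fix the image
  of \<open>A\<close>, and an increasing map is determined by its image.  For shuffles with a block of size 1, this
  leaves one parameter, the destination of the single letter.
\<close>

lemma permutes_eqI_strict_mono_on:
  fixes s t :: "'a::wellorder \<Rightarrow> 'a"
  assumes s: "s permutes S" "strict_mono_on A s" and t: "t permutes S" "strict_mono_on A t"
    and "A \<subseteq> S" and eq: "\<And>x. x \<in> S - A \<Longrightarrow> s x = t x"
  shows "s = t"
proof
  fix x
  have im: "u ` A = S - u ` (S - A)" if "u permutes S" for u
  proof -
    have "u ` (S - (S - A)) = u ` S - u ` (S - A)"
      by (intro image_set_diff permutes_inj[OF that])
    then show ?thesis using \<open>A \<subseteq> S\<close> by (simp add: permutes_image[OF that] double_diff)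
  qed
  have "s ` (S - A) = t ` (S - A)"
    using eq by (intro image_cong) auto
  then have "s ` A = t ` A"
    using im[OF s(1)] im[OF t(1)] by simp
  then show "s x = t x"
    using strict_mono_on_image_unique[OF s(2) t(2)] eq permutes_not_in[OF s(1)] permutes_not_in[OF t(1)]
    by (cases "x \<in> A"; cases "x \<in> S") auto
qed

lemma sum_shuffles_one_left:
  "(\<Sum>s\<in>shuffles_perm 1 m. F (inv s)) = (\<Sum>k\<in>{1..Suc m}. F (word_perm [1..<k]))"
proof -
  have S: "s \<in> shuffles_perm 1 m \<longleftrightarrow> s permutes {1..Suc m} \<and> strict_mono_on {2..Suc m} s" for s
    by (auto simp: shuffles_perm_def strict_mono_on_def numeral_2_eq_2)
  have mem: "word_perm (rev [1..<k]) \<in> shuffles_perm 1 m" if "k \<in> {1..Suc m}" for k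
    unfolding S using that
    by (intro conjI word_perm_permutes strict_mono_onI) (auto simp: word_perm_rev_upt)
  have eq: "word_perm (rev [1..<s 1]) = s" and s1: "s 1 \<in> {1..Suc m}" if "s \<in> shuffles_perm 1 m" for s
  proof -
    from that[unfolded S] have s: "s permutes {1..Suc m}" "strict_mono_on {2..Suc m} s" by simp_all
    show s1: "s 1 \<in> {1..Suc m}" using permutes_in_image[OF s(1), of 1] by simp
    from mem[OF s1, unfolded S] have t: "word_perm (rev [1..<s 1]) permutes {1..Suc m}"
        "strict_mono_on {2..Suc m} (word_perm (rev [1..<s 1]))" by simp_all
    show "word_perm (rev [1..<s 1]) = s"
    proof (rule permutes_eqI_strict_mono_on[OF t s])
      fix x assume "x \<in> {1..Suc m} - {2..Suc m}"
      then have "x = 1" by auto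
      then show "word_perm (rev [1..<s 1]) x = s x" using s1 by (simp add: word_perm_rev_upt)
    qed auto
  qed
  show ?thesis
    by (rule sum.reindex_bij_witness[where i = "\<lambda>k. word_perm (rev [1..<k])" and j = "\<lambda>s. s 1"])
      (use mem eq s1 in \<open>auto simp: word_perm_rev_upt\<close>, metis inv_word_perm rev_rev_ident)
qed

lemma sum_shuffles_one_right:
  "(\<Sum>s\<in>shuffles_perm m 1. F (inv s)) = (\<Sum>k\<in>{1..Suc m}. F (word_perm (rev [k..<Suc m])))"
proof -
  have S: "s \<in> shuffles_perm m 1 \<longleftrightarrow> s permutes {1..Suc m} \<and> strict_mono_on {1..m} s" for s
    by (auto simp: shuffles_perm_def strict_mono_on_def)
  have mem: "word_perm [k..<Suc m] \<in> shuffles_perm m 1" if "k \<in> {1..Suc m}" for k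
    unfolding S using that
    by (intro conjI word_perm_permutes strict_mono_onI) (auto simp: word_perm_upt simp del: upt_Suc)
  have eq: "word_perm [s (Suc m)..<Suc m] = s" and s1: "s (Suc m) \<in> {1..Suc m}"
    if "s \<in> shuffles_perm m 1" for s
  proof -
    from that[unfolded S] have s: "s permutes {1..Suc m}" "strict_mono_on {1..m} s" by simp_all
    show s1: "s (Suc m) \<in> {1..Suc m}" using permutes_in_image[OF s(1), of "Suc m"] by simp
    from mem[OF s1, unfolded S] have t: "word_perm [s (Suc m)..<Suc m] permutes {1..Suc m}"
        "strict_mono_on {1..m} (word_perm [s (Suc m)..<Suc m])" by simp_all
    show "word_perm [s (Suc m)..<Suc m] = s"
    proof (rule permutes_eqI_strict_mono_on[OF t s])
      fix x assume "x \<in> {1..Suc m} - {1..m}"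
      then have "x = Suc m" by auto
      then show "word_perm [s (Suc m)..<Suc m] x = s x" using s1 by (simp add: word_perm_upt del: upt_Suc)
    qed auto
  qed
  show ?thesis
    by (rule sum.reindex_bij_witness[where i = "\<lambda>k. word_perm [k..<Suc m]" and j = "\<lambda>s. s (Suc m)"])
      (use mem eq s1 in \<open>auto simp: word_perm_upt simp del: upt_Suc\<close>, metis inv_word_perm)
qed


section \<open>Words in braid generators\<close>

lemma foldr_comp_apply: "foldr (\<lambda>i F. f i \<circ> F) is id x = foldr f is x"
  by (induction "is") simp_all

text \<open>
  In the braid monoid, \<open>(\<sigma>\<^sub>1 \<cdots> \<sigma>\<^sub>n) \<sigma>\<^sub>i = \<sigma>\<^sub>i\<^sub>+\<^sub>1 (\<sigma>\<^sub>1 \<cdots> \<sigma>\<^sub>n)\<close>: the word \<open>\<sigma>\<^sub>1 \<cdots> \<sigma>\<^sub>n\<close> pulls the last strand in front of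
  the others, so the crossing of strands \<open>i\<close> and \<open>i + 1\<close> becomes the crossing of the next two strands.
  Algebraically, \<open>\<sigma>\<^sub>i\<close> commutes with the letters after \<open>\<sigma>\<^sub>i \<sigma>\<^sub>i\<^sub>+\<^sub>1\<close>, the braid relation turns
  \<open>\<sigma>\<^sub>i \<sigma>\<^sub>i\<^sub>+\<^sub>1 \<sigma>\<^sub>i\<close> into \<open>\<sigma>\<^sub>i\<^sub>+\<^sub>1 \<sigma>\<^sub>i \<sigma>\<^sub>i\<^sub>+\<^sub>1\<close>, and the new letter \<open>\<sigma>\<^sub>i\<^sub>+\<^sub>1\<close> commutes with those before \<open>\<sigma>\<^sub>i\<close>.
\<close>

lemma foldr_braid_shift:
  fixes g :: "nat \<Rightarrow> 'a \<Rightarrow> 'a"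
  assumes closed: "\<And>i x. 1 \<le> i \<Longrightarrow> i \<le> n \<Longrightarrow> x \<in> X \<Longrightarrow> g i x \<in> X"
    and far: "\<And>i j x. 1 \<le> i \<Longrightarrow> i + 1 < j \<Longrightarrow> j \<le> n \<Longrightarrow> x \<in> X \<Longrightarrow> g j (g i x) = g i (g j x)"
    and braid: "\<And>i x. 1 \<le> i \<Longrightarrow> i < n \<Longrightarrow> x \<in> X \<Longrightarrow> g i (g (Suc i) (g i x)) = g (Suc i) (g i (g (Suc i) x))"
    and i: "1 \<le> i" "i < n" and x: "x \<in> X"
  shows "foldr g [1..<Suc n] (g i x) = g (Suc i) (foldr g [1..<Suc n] x)"
proof -
  have closed_word: "foldr g is y \<in> X" if "set is \<subseteq> {1..n}" "y \<in> X" for "is" y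
    using that by (induction "is") (auto intro: closed)
  have high: "foldr g is (g i y) = g i (foldr g is y)" if "set is \<subseteq> {i + 2..n}" "y \<in> X" for "is" y
    using that
  proof (induction "is")
    case (Cons j js)
    have "foldr g js y \<in> X" using Cons.prems i by (intro closed_word) auto
    then show ?case using Cons i far[of i j "foldr g js y"] by simp
  qed simp
  have low: "foldr g is (g (Suc i) y) = g (Suc i) (foldr g is y)" if "set is \<subseteq> {1..<i}" "y \<in> X" for "is" y
    using that
  proof (induction "is")
    case (Cons j js)
    have "foldr g js y \<in> X" using Cons.prems i by (intro closed_word) auto
    then show ?case using Cons i far[of j "Suc i" "foldr g js y"] by simp
  qed simp
  define z where "z = foldr g [i + 2..<Suc n] x"
  have z: "z \<in> X" unfolding z_def using x by (intro closed_word) auto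
  have high_z: "foldr g [i + 2..<Suc n] (g i x) = g i z"
    unfolding z_def by (rule high) (use x in auto)
  have upt: "[1..<Suc n] = [1..<i] @ [i, Suc i] @ [i + 2..<Suc n]"
  proof -
    have "[1..<Suc n] = [1..<i] @ [i..<Suc n]"
      using i upt_add_eq_append[of 1 i "Suc n - i"] by simp
    then show ?thesis using i by (simp add: upt_conv_Cons del: upt_Suc)
  qed
  have "foldr g [1..<Suc n] (g i x) = foldr g [1..<i] (g i (g (Suc i) (g i z)))"
    unfolding upt by (simp add: high_z del: upt_Suc add_2_eq_Suc')
  also have "\<dots> = foldr g [1..<i] (g (Suc i) (g i (g (Suc i) z)))"
    using braid i z by simp
  also have "\<dots> = g (Suc i) (foldr g [1..<i] (g i (g (Suc i) z)))"
    by (rule low) (use i z in \<open>auto intro!: closed\<close>)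
  finally show ?thesis
    unfolding upt z_def by (simp del: upt_Suc)
qed

locale pre_braided = tensor_space scale
  for scale :: "'k::field \<Rightarrow> 'v::ab_group_add \<Rightarrow> 'v" +
  fixes \<sigma> :: "('k, 'v) tensor \<Rightarrow> ('k, 'v) tensor"
  assumes pre_braiding: "pre_braiding scale \<sigma>"
begin

abbreviation braid_at :: "nat \<Rightarrow> nat \<Rightarrow> ('k, 'v) tensor \<Rightarrow> ('k, 'v) tensor"
  where "braid_at n \<equiv> act_at scale n 2 \<sigma>"
abbreviation braid_word :: "nat \<Rightarrow> nat list \<Rightarrow> ('k, 'v) tensor \<Rightarrow> ('k, 'v) tensor"
  where "braid_word n \<equiv> foldr (braid_at n)"
abbreviation form_at :: "nat \<Rightarrow> ('v \<Rightarrow> 'k) \<Rightarrow> nat \<Rightarrow> ('k, 'v) tensor \<Rightarrow> ('k, 'v) tensor"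
  where "form_at n f \<equiv> act_at scale n 1 (form_map scale f)"

lemma sigma_linear_between: "linear_between (TP 2) (TP 2) \<sigma>"
  using pre_braiding by (simp add: pre_braiding_def)

lemma braid_at_linear_between:
  assumes "1 \<le> i" "i < n"
  shows "linear_between (TP n) (TP n) (braid_at n i)"
  by (rule act_at_linear_between[OF sigma_linear_between, where a = "i - 1" and b = "n - i - 1"])
    (use assms in auto)

lemma braid_at_in_power: "1 \<le> i \<Longrightarrow> i < n \<Longrightarrow> x \<in> TP n \<Longrightarrow> braid_at n i x \<in> TP n"
  by (rule linear_betweenD(1)[OF braid_at_linear_between])

lemma braid_at_commute:
  assumes "1 \<le> i" "i + 1 < j" "j < n" "x \<in> TP n"
  shows "braid_at n j (braid_at n i x) = braid_at n i (braid_at n j x)"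
  by (rule act_at_interchange[OF sigma_linear_between sigma_linear_between assms(4),
        where a = "i - 1" and b = "j - i - 2" and c = "n - j - 1"]) (use assms in auto)

lemma braid_at_braid:
  assumes "1 \<le> i" "Suc i < n" "x \<in> TP n"
  shows "braid_at n i (braid_at n (Suc i) (braid_at n i x)) = braid_at n (Suc i) (braid_at n i (braid_at n (Suc i) x))"
proof (rule power_split3_eqI[OF _ _ assms(3)])
  have i: "linear_between (TP n) (TP n) (braid_at n i)" and j: "linear_between (TP n) (TP n) (braid_at n (Suc i))"
    using assms by (auto intro: braid_at_linear_between)
  show "linear_between (TP n) (TP n) (\<lambda>x. braid_at n i (braid_at n (Suc i) (braid_at n i x)))"
    by (rule linear_between_comp[OF linear_between_comp[OF i j] i])
  show "linear_between (TP n) (TP n) (\<lambda>x. braid_at n (Suc i) (braid_at n i (braid_at n (Suc i) x)))"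
    by (rule linear_between_comp[OF linear_between_comp[OF j i] j])
  show "n = (i - 1) + 3 + (n - i - 2)" using assms by simp
  fix u v w assume uvw: "u \<in> TP (i - 1)" "v \<in> TP 3" "w \<in> TP (n - i - 2)"
  have 1: "braid_at n i (u \<odot> y \<odot> w) = u \<odot> braid_at 3 1 y \<odot> w" if "y \<in> TP 3" for y
    by (rule act_at_pad[OF sigma_linear_between uvw(1) that uvw(3), where c = 0 and d = 1])
      (use assms in auto)
  have 2: "braid_at n (Suc i) (u \<odot> y \<odot> w) = u \<odot> braid_at 3 2 y \<odot> w" if "y \<in> TP 3" for y
    by (rule act_at_pad[OF sigma_linear_between uvw(1) that uvw(3), where c = 1 and d = 0])
      (use assms in auto)
  have mem: "braid_at 3 1 y \<in> TP 3" "braid_at 3 2 y \<in> TP 3" if "y \<in> TP 3" for y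
    using that by (auto intro: braid_at_in_power)
  have "braid_at 3 1 (braid_at 3 2 (braid_at 3 1 v)) = braid_at 3 2 (braid_at 3 1 (braid_at 3 2 v))"
    using pre_braiding uvw(2) by (simp add: pre_braiding_def Let_def)
  then show "braid_at n i (braid_at n (Suc i) (braid_at n i (u \<odot> v \<odot> w))) = braid_at n (Suc i) (braid_at n i (braid_at n (Suc i) (u \<odot> v \<odot> w)))"
    by (simp only: 1 2 mem uvw)
qed

lemma braid_word_linear_between:
  "set is \<subseteq> {1..<n} \<Longrightarrow> linear_between (TP n) (TP n) (braid_word n is)"
proof (induction "is")
  case Nil
  then show ?case using linear_between_id[of "TP n"] by (simp add: id_def)
next
  case (Cons i "is")
  then have "linear_between (TP n) (TP n) (braid_word n is)" "linear_between (TP n) (TP n) (braid_at n i)"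
    by (auto intro: braid_at_linear_between)
  from linear_between_comp[OF this] show ?case
    by (simp add: comp_def)
qed

lemma braid_word_in_power: "set is \<subseteq> {1..<n} \<Longrightarrow> x \<in> TP n \<Longrightarrow> braid_word n is x \<in> TP n"
  by (rule linear_betweenD(1)[OF braid_word_linear_between])

lemma braid_word_mult_right:
  assumes "set is \<subseteq> {1..<n}" "y \<in> TP n" "z \<in> TP b" "m = n + b"
  shows "braid_word m is (y \<odot> z) = braid_word n is y \<odot> z"
  using assms(1)
proof (induction "is")
  case (Cons i "is")
  have mem: "braid_word n is y \<in> TP n"
    using Cons.prems assms(2) by (intro braid_word_in_power) auto
  have "braid_at m i (braid_word n is y \<odot> z) = braid_at n i (braid_word n is y) \<odot> z"
    by (rule act_at_pad_right[OF sigma_linear_between mem assms(3),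
          where c = "i - 1" and d = "n - i - 1"]) (use Cons.prems assms(4) in auto)
  then show ?case using Cons by simp
qed simp

lemma form_at_linear_between:
  assumes "Vector_Spaces.linear scale (*) f" "1 \<le> i" "i \<le> Suc n"
  shows "linear_between (TP (Suc n)) (TP n) (form_at (Suc n) f i)"
  by (rule act_at_linear_between[OF form_map_linear_between[OF assms(1)],
        where a = "i - 1" and b = "Suc n - i"]) (use assms in auto)

lemma form_at_mult_right:
  assumes "Vector_Spaces.linear scale (*) f" "y \<in> TP n" "z \<in> TP b" "m = n + b" "1 \<le> i" "i \<le> n"
  shows "form_at m f i (y \<odot> z) = form_at n f i y \<odot> z"
  by (rule act_at_pad_right[OF form_map_linear_between[OF assms(1)] assms(2,3),
        where c = "i - 1" and d = "n - i"]) (use assms in auto)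

text \<open>
  Removing the first factor renumbers the remaining ones, hence the shifted word.
\<close>

lemma braid_word_form_at_first:
  assumes f: "Vector_Spaces.linear scale (*) f" and "set is \<subseteq> {1..<n}" and x: "x \<in> TP (Suc n)"
  shows "braid_word n is (form_at (Suc n) f 1 x) = form_at (Suc n) f 1 (braid_word (Suc n) (map Suc is) x)"
  using assms(2)
proof (induction "is")
  case (Cons i "is")
  have mem: "braid_word (Suc n) (map Suc is) x \<in> TP (Suc n)"
    using Cons.prems x by (intro braid_word_in_power) auto
  have "braid_at n i (form_at (Suc n) f 1 (braid_word (Suc n) (map Suc is) x)) =
      form_at (Suc n) f 1 (braid_at (Suc n) (Suc i) (braid_word (Suc n) (map Suc is) x))"
    by (rule act_at_interchange[OF form_map_linear_between[OF f] sigma_linear_between mem,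
          where a = 0 and b = "i - 1" and c = "n - i - 1"]) (use Cons.prems in auto)
  then show ?case using Cons by simp
qed simp

lemma form_at_last_braid_word:
  assumes f: "Vector_Spaces.linear scale (*) f" and "set is \<subseteq> {1..<n}" and x: "x \<in> TP (Suc n)"
  shows "form_at (Suc n) f (Suc n) (braid_word (Suc n) is x) = braid_word n is (form_at (Suc n) f (Suc n) x)"
  using assms(2)
proof (induction "is")
  case (Cons i "is")
  have mem: "braid_word (Suc n) is x \<in> TP (Suc n)"
    using Cons.prems x by (intro braid_word_in_power) auto
  have "form_at (Suc n) f (Suc n) (braid_at (Suc n) i (braid_word (Suc n) is x)) =
      braid_at n i (form_at (Suc n) f (Suc n) (braid_word (Suc n) is x))"
    by (rule act_at_interchange[OF sigma_linear_between form_map_linear_between[OF f] mem,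
          where a = "i - 1" and b = "n - i - 1" and c = 0]) (use Cons.prems in auto)
  then show ?case using Cons by simp
qed simp

lemma form_at_last_first:
  assumes f: "Vector_Spaces.linear scale (*) f" and g: "Vector_Spaces.linear scale (*) g"
    and x: "x \<in> TP (Suc (Suc n))"
  shows "form_at (Suc n) g (Suc n) (form_at (Suc (Suc n)) f 1 x) =
    form_at (Suc n) f 1 (form_at (Suc (Suc n)) g (Suc (Suc n)) x)"
  by (rule act_at_interchange[OF form_map_linear_between[OF f] form_map_linear_between[OF g] x,
        where a = 0 and b = n and c = 0]) auto

lemma braid_word_shift:
  assumes "set is \<subseteq> {1..<n}" and x: "x \<in> TP (Suc n)"
  shows "braid_word (Suc n) [1..<Suc n] (braid_word (Suc n) is x) =
    braid_word (Suc n) (map Suc is) (braid_word (Suc n) [1..<Suc n] x)"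
  using assms(1)
proof (induction "is")
  case (Cons i "is")
  have mem: "braid_word (Suc n) is x \<in> TP (Suc n)"
    using Cons.prems x by (intro braid_word_in_power) auto
  have "braid_word (Suc n) [1..<Suc n] (braid_at (Suc n) i (braid_word (Suc n) is x)) =
      braid_at (Suc n) (Suc i) (braid_word (Suc n) [1..<Suc n] (braid_word (Suc n) is x))"
    by (rule foldr_braid_shift[where X = "TP (Suc n)"])
      (use Cons.prems mem in \<open>auto intro: braid_at_in_power braid_at_commute braid_at_braid\<close>)
  then show ?case using Cons by simp
qed simp

lemma braid_word_uminus:
  assumes "set is \<subseteq> {1..<n}" "x \<in> TP n"
  shows "foldr (act_at scale n 2 (- \<sigma>)) is x = tscale ((- 1) ^ length is) (braid_word n is x)"
  using assms(1)
proof (induction "is")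
  case (Cons i "is")
  have mem: "braid_word n is x \<in> TP n"
    using Cons.prems assms(2) by (intro braid_word_in_power) auto
  then have mem': "tscale ((- 1) ^ length is) (braid_word n is x) \<in> TP n"
    by (rule scale_in_power)
  have i: "1 \<le> i" "i < n" using Cons.prems by auto
  have "act_at scale n 2 (- \<sigma>) i (tscale ((- 1) ^ length is) (braid_word n is x)) =
      tscale (- 1) (braid_at n i (tscale ((- 1) ^ length is) (braid_word n is x)))"
    by (rule act_at_uminus[OF sigma_linear_between mem', where a = "i - 1" and b = "n - i - 1"])
      (use i in auto)
  also have "\<dots> = tscale ((- 1) ^ length (i # is)) (braid_at n i (braid_word n is x))"
    using linear_betweenD(3)[OF braid_at_linear_between[OF i] mem] by simp
  finally show ?case using Cons by simp
qed simp


section \<open>The differentials and the arrow operation as explicit sums\<close>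

text \<open>
  The \<open>k\<close>-th factor is pulled to the front by \<open>\<sigma>\<^sub>1 \<cdots> \<sigma>\<^sub>k\<^sub>-\<^sub>1\<close>, or pushed to the end by
  \<open>\<sigma>\<^sub>n\<^sub>-\<^sub>1 \<cdots> \<sigma>\<^sub>k\<close>, and absorbed there.  Both differentials are alternating sums of these terms over \<open>k\<close>.
\<close>

definition left_term :: "nat \<Rightarrow> ('v \<Rightarrow> 'k) \<Rightarrow> nat \<Rightarrow> ('k, 'v) tensor \<Rightarrow> ('k, 'v) tensor" where
  "left_term n f k x = form_at n f 1 (braid_word n [1..<k] x)"

definition right_term :: "nat \<Rightarrow> ('v \<Rightarrow> 'k) \<Rightarrow> nat \<Rightarrow> ('k, 'v) tensor \<Rightarrow> ('k, 'v) tensor" where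
  "right_term n f k x = form_at n f n (braid_word n (rev [k..<n]) x)"

lemma left_term_linear_between:
  assumes f: "Vector_Spaces.linear scale (*) f" and "k \<in> {1..n}"
  shows "linear_between (TP n) (TP (n - 1)) (left_term n f k)"
proof -
  obtain m where n: "n = Suc m" using assms(2) by (cases n) auto
  have w: "linear_between (TP n) (TP n) (braid_word n [1..<k])"
    by (rule braid_word_linear_between) (use assms(2) in auto)
  have e: "linear_between (TP n) (TP (n - 1)) (form_at n f 1)"
    unfolding n diff_Suc_1 by (rule form_at_linear_between[OF f]) auto
  show ?thesis using linear_between_comp[OF w e] by (simp add: left_term_def[abs_def])
qed

lemma right_term_linear_between:
  assumes f: "Vector_Spaces.linear scale (*) f" and "k \<in> {1..n}"
  shows "linear_between (TP n) (TP (n - 1)) (right_term n f k)"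
proof -
  obtain m where n: "n = Suc m" using assms(2) by (cases n) auto
  have w: "linear_between (TP n) (TP n) (braid_word n (rev [k..<n]))"
    by (rule braid_word_linear_between) (use assms(2) in auto)
  have e: "linear_between (TP n) (TP (n - 1)) (form_at n f n)"
    unfolding n diff_Suc_1 by (rule form_at_linear_between[OF f]) auto
  show ?thesis using linear_between_comp[OF w e] by (simp add: right_term_def[abs_def])
qed

lemma csh_one_left:
  assumes x: "x \<in> TP (Suc m)"
  shows "csh scale (- \<sigma>) 1 m x = (\<Sum>k\<in>{1..Suc m}. tscale ((- 1) ^ (k - 1)) (braid_word (Suc m) [1..<k] x))"
  unfolding csh_def sum_shuffles_one_left[where F = "\<lambda>u. braid_lift scale (- \<sigma>) (1 + m) u x"]
proof (rule sum.cong[OF refl])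
  fix k assume k: "k \<in> {1..Suc m}"
  then have "shortest_word (Suc m) (word_perm [1..<k]) = [1..<k]"
    by (intro shortest_word_upt) auto
  then show "braid_lift scale (- \<sigma>) (1 + m) (word_perm [1..<k]) x = tscale ((- 1) ^ (k - 1)) (braid_word (Suc m) [1..<k] x)"
    using braid_word_uminus[of "[1..<k]" "Suc m" x] k x
    by (simp add: braid_lift_def foldr_comp_apply)
qed

lemma csh_one_right:
  assumes x: "x \<in> TP (Suc m)"
  shows "csh scale (- \<sigma>) m 1 x =
    (\<Sum>k\<in>{1..Suc m}. tscale ((- 1) ^ (Suc m - k)) (braid_word (Suc m) (rev [k..<Suc m]) x))"
  unfolding csh_def sum_shuffles_one_right[where F = "\<lambda>u. braid_lift scale (- \<sigma>) (m + 1) u x"]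
proof (rule sum.cong[OF refl])
  fix k assume k: "k \<in> {1..Suc m}"
  then have "shortest_word (Suc m) (word_perm (rev [k..<Suc m])) = rev [k..<Suc m]"
    by (intro shortest_word_rev_upt) auto
  then show "braid_lift scale (- \<sigma>) (m + 1) (word_perm (rev [k..<Suc m])) x =
      tscale ((- 1) ^ (Suc m - k)) (braid_word (Suc m) (rev [k..<Suc m]) x)"
    using braid_word_uminus[of "rev [k..<Suc m]" "Suc m" x] k x
    by (simp add: braid_lift_def foldr_comp_apply del: upt_Suc)
qed

lemma left_d_eq:
  assumes f: "Vector_Spaces.linear scale (*) f" and x: "x \<in> TP n"
  shows "left_d scale \<sigma> f x = (\<Sum>k\<in>{1..n}. tscale ((- 1) ^ (k - 1)) (left_term n f k x))"
  unfolding left_d_def assemble_def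
proof (rule lin_ext_graded[OF _ _ x])
  let ?E = "\<lambda>n x. \<Sum>k\<in>{1..n}. tscale ((- 1) ^ (k - 1)) (left_term n f k x)"
  show "linear_between (TP n) TA (?E n)" for n
    by (rule linear_between_mono[OF linear_between_sum[OF left_term_linear_between[OF f]] power_subset_algebra])
  fix vs :: "'v list"
  show "(if length vs = 0 then 0
      else act_at scale (length vs) 1 (form_map scale f) 1 (csh scale (- \<sigma>) 1 (length vs - 1) (P vs))) =
    ?E (length vs) (P vs)"
  proof (cases "length vs")
    case (Suc m)
    have e: "linear_between (TP (Suc m)) (TP m) (form_at (Suc m) f 1)"
      by (rule form_at_linear_between[OF f]) auto
    have vs: "P vs \<in> TP (Suc m)" using Suc by simp
    have mem: "braid_word (Suc m) [1..<k] (P vs) \<in> TP (Suc m)" if "k \<in> {1..Suc m}" for k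
      by (rule braid_word_in_power) (use that vs in auto)
    have "form_at (Suc m) f 1 (csh scale (- \<sigma>) 1 m (P vs)) = ?E (Suc m) (P vs)"
      unfolding csh_one_left[OF vs] left_term_def
      by (rule linear_between_of_sum[OF e mem])
    then show ?thesis
      unfolding Suc by (simp only: nat.distinct if_False diff_Suc_1)
  qed simp
qed

lemma right_d_eq:
  assumes f: "Vector_Spaces.linear scale (*) f" and x: "x \<in> TP n"
  shows "right_d scale \<sigma> f x = (\<Sum>k\<in>{1..n}. tscale ((- 1) ^ (k - 1)) (right_term n f k x))"
  unfolding right_d_def assemble_def
proof (rule lin_ext_graded[OF _ _ x])
  let ?E = "\<lambda>n x. \<Sum>k\<in>{1..n}. tscale ((- 1) ^ (k - 1)) (right_term n f k x)"
  show "linear_between (TP n) TA (?E n)" for n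
    by (rule linear_between_mono[OF linear_between_sum[OF right_term_linear_between[OF f]] power_subset_algebra])
  fix vs :: "'v list"
  show "(if length vs = 0 then 0
      else tscale ((- 1) ^ (length vs - 1)) (act_at scale (length vs) 1 (form_map scale f) (length vs)
        (csh scale (- \<sigma>) (length vs - 1) 1 (P vs)))) = ?E (length vs) (P vs)"
  proof (cases "length vs")
    case (Suc m)
    have e: "linear_between (TP (Suc m)) (TP m) (form_at (Suc m) f (Suc m))"
      by (rule form_at_linear_between[OF f]) auto
    have vs: "P vs \<in> TP (Suc m)" using Suc by simp
    have mem: "braid_word (Suc m) (rev [k..<Suc m]) (P vs) \<in> TP (Suc m)" if "k \<in> {1..Suc m}" for k
      by (rule braid_word_in_power) (use that vs in auto)
    \<comment> \<open>The global sign \<open>(- 1)\<^sup>n\<^sup>-\<^sup>1\<close> combines with the \<open>n - k\<close> signs of the word; here \<open>n = Suc m\<close>.\<close>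
    have sign: "(- 1) ^ m * (- 1) ^ (Suc m - k) = ((- 1) ^ (k - 1) :: 'k)" if "k \<in> {1..Suc m}" for k
    proof -
      have "m + (Suc m - k) = (k - 1) + 2 * (Suc m - k)" using that by auto
      then show ?thesis
        by (simp only: power_add[symmetric]) (simp only: power_add power_mult power2_minus power_one mult_1_right)
    qed
    have "tscale ((- 1) ^ m) (form_at (Suc m) f (Suc m) (csh scale (- \<sigma>) m 1 (P vs))) =
        (\<Sum>k\<in>{1..Suc m}. tscale ((- 1) ^ m) (tscale ((- 1) ^ (Suc m - k)) (right_term (Suc m) f k (P vs))))"
      unfolding csh_one_right[OF vs] right_term_def T.scale_sum_right[symmetric]
      by (rule arg_cong[OF linear_between_of_sum[OF e mem]])
    also have "\<dots> = ?E (Suc m) (P vs)"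
      unfolding T.scale_scale by (rule sum.cong[OF refl], subst sign) auto
    finally show ?thesis
      unfolding Suc by (simp only: nat.distinct if_False diff_Suc_1)
  qed simp
qed

lemma arrow_linear_between:
  assumes f: "Vector_Spaces.linear scale (*) f"
  shows "linear_between (TP n) (TP n) (\<lambda>x. form_at (Suc n) f 1 (braid_word (Suc n) [1..<Suc n] (x \<odot> P [w])))"
proof -
  have m: "linear_between (TP n) (TP (Suc n)) (\<lambda>x. x \<odot> P [w])"
    using linear_between_mult_left[of "P [w]" 1 n] by simp
  have s: "linear_between (TP (Suc n)) (TP (Suc n)) (braid_word (Suc n) [1..<Suc n])"
    by (rule braid_word_linear_between) auto
  have e: "linear_between (TP (Suc n)) (TP n) (form_at (Suc n) f 1)"
    by (rule form_at_linear_between[OF f]) auto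
  show ?thesis by (rule linear_between_comp[OF linear_between_comp[OF m s] e])
qed

lemma arrow_op_linear: "Vector_Spaces.linear tscale tscale (arrow_op scale \<sigma> f w)"
  unfolding arrow_op_def assemble_def by (rule linear_lin_ext)

lemma arrow_op_eq:
  assumes f: "Vector_Spaces.linear scale (*) f" and x: "x \<in> TP n"
  shows "arrow_op scale \<sigma> f w x = form_at (Suc n) f 1 (braid_word (Suc n) [1..<Suc n] (x \<odot> P [w]))"
  unfolding arrow_op_def assemble_def
proof (rule lin_ext_graded[OF _ _ x])
  show "linear_between (TP n) TA (\<lambda>x. form_at (Suc n) f 1 (braid_word (Suc n) [1..<Suc n] (x \<odot> P [w])))" for n
    by (rule linear_between_mono[OF arrow_linear_between[OF f] power_subset_algebra])
qed (simp del: upt_Suc)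

lemma arrow_op_in_power:
  "Vector_Spaces.linear scale (*) f \<Longrightarrow> x \<in> TP n \<Longrightarrow> arrow_op scale \<sigma> f w x \<in> TP n"
  by (simp only: arrow_op_eq) (rule linear_betweenD(1)[OF arrow_linear_between])


section \<open>The arrow operation commutes with the differentials\<close>

text \<open>
  The proof happens in \<open>V\<^sup>\<otimes>\<^sup>n \<otimes> w\<close>.  Moving \<open>f\<close> to the outside turns the left-hand side into \<open>f \<otimes> g\<close> applied
  after pulling \<open>w\<close> to the front and then, from behind it, the \<open>k\<close>-th factor to the second place.  By
  the shift identity this equals first pulling the \<open>k\<close>-th factor to the front and then \<open>w\<close> in front of
  it.  The last crossing of this motion exchanges exactly these two, and compatibility trades it for
  \<open>g \<otimes> f\<close>; so \<open>g\<close> absorbs its factor first and \<open>f\<close> absorbs \<open>w\<close>, which is the right-hand side.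
\<close>

lemma left_term_arrow_op:
  assumes f: "Vector_Spaces.linear scale (*) f" and g: "Vector_Spaces.linear scale (*) g"
    and compat: "\<And>y. y \<in> TP 2 \<Longrightarrow> form2 scale f g (\<sigma> y) = form2 scale g f y"
    and x: "x \<in> TP n" and k: "k \<in> {1..n}"
  shows "left_term n g k (arrow_op scale \<sigma> f w x) = arrow_op scale \<sigma> f w (left_term n g k x)"
proof -
  obtain m where n: "n = Suc m" using k by (cases n) auto
  let ?N = "Suc (Suc m)"
  let ?y = "x \<odot> P [w]"
  have y: "?y \<in> TP ?N"
    using mult_in_power[OF x pure_in_power[of "[w]" 1]] by (simp add: n)
  have short: "set [1..<k] \<subseteq> {1..<Suc m}" using k n by auto
  have swap: "act_at scale ?N 2 (form2 scale g f) 1 z = act_at scale ?N 2 (form2 scale f g) 1 (braid_at ?N 1 z)"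
    if "z \<in> TP ?N" for z
  proof (rule power_split3_eqI[OF _ _ that])
    show "linear_between (TP ?N) (TP m) (act_at scale ?N 2 (form2 scale g f) 1)"
      by (rule act_at_linear_between[OF form2_linear_between[OF g f], where a = 0 and b = m]) auto
    have fg: "linear_between (TP ?N) (TP m) (act_at scale ?N 2 (form2 scale f g) 1)"
      by (rule act_at_linear_between[OF form2_linear_between[OF f g], where a = 0 and b = m]) auto
    show "linear_between (TP ?N) (TP m) (\<lambda>z. act_at scale ?N 2 (form2 scale f g) 1 (braid_at ?N 1 z))"
      by (rule linear_between_comp[OF braid_at_linear_between fg]) auto
    show "?N = 0 + 2 + m" by simp
    fix u v r assume uvr: "u \<in> TP 0" "v \<in> TP 2" "r \<in> TP m"
    have num: "?N = 0 + 2 + m" "1 = Suc 0" by simp_all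
    have sv: "\<sigma> v \<in> TP 2" using linear_betweenD(1)[OF sigma_linear_between uvr(2)] .
    show "act_at scale ?N 2 (form2 scale g f) 1 (u \<odot> v \<odot> r) =
        act_at scale ?N 2 (form2 scale f g) 1 (braid_at ?N 1 (u \<odot> v \<odot> r))"
      unfolding act_at_mult[OF form2_linear_between[OF g f] uvr num]
        act_at_mult[OF sigma_linear_between uvr num]
        act_at_mult[OF form2_linear_between[OF f g] uvr(1) sv uvr(3) num] compat[OF uvr(2)] ..
  qed
  have wy: "braid_word ?N [1..<?N] ?y \<in> TP ?N"
    by (rule braid_word_in_power[OF _ y]) auto
  have wk: "braid_word ?N [1..<k] ?y \<in> TP ?N"
    by (rule braid_word_in_power[OF _ y]) (use short in auto)
  have split: "[1..<?N] = 1 # map Suc [1..<Suc m]"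
    by (simp add: map_Suc_upt upt_conv_Cons del: upt_Suc)
  have mem2: "braid_word ?N (map Suc [1..<Suc m]) (braid_word ?N [1..<k] ?y) \<in> TP ?N"
    by (rule braid_word_in_power[OF _ wk]) auto
  have lt: "left_term n g k x \<in> TP m"
    using linear_betweenD(1)[OF left_term_linear_between[OF g k] x] by (simp add: n)
  have "left_term n g k (arrow_op scale \<sigma> f w x) =
      form_at (Suc m) g 1 (braid_word (Suc m) [1..<k] (form_at ?N f 1 (braid_word ?N [1..<?N] ?y)))"
    unfolding left_term_def arrow_op_eq[OF f x] n ..
  also have "\<dots> = form_at (Suc m) g 1 (form_at ?N f 1 (braid_word ?N (map Suc [1..<k]) (braid_word ?N [1..<?N] ?y)))"
    by (subst braid_word_form_at_first[OF f short wy]) (rule refl)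
  also have "\<dots> = form_at (Suc m) g 1 (form_at ?N f 1 (braid_word ?N [1..<?N] (braid_word ?N [1..<k] ?y)))"
    by (subst braid_word_shift[OF short y]) (rule refl)
  also have "\<dots> = act_at scale ?N 2 (form2 scale f g) 1 (braid_word ?N [1..<?N] (braid_word ?N [1..<k] ?y))"
    by (rule forms_at_first[OF f g]) (rule braid_word_in_power[OF _ wk], auto)
  also have "\<dots> = act_at scale ?N 2 (form2 scale f g) 1 (braid_at ?N 1 (braid_word ?N (map Suc [1..<Suc m]) (braid_word ?N [1..<k] ?y)))"
    unfolding split by simp
  also have "\<dots> = act_at scale ?N 2 (form2 scale g f) 1 (braid_word ?N (map Suc [1..<Suc m]) (braid_word ?N [1..<k] ?y))"
    by (rule swap[OF mem2, symmetric])
  also have "\<dots> = form_at (Suc m) f 1 (form_at ?N g 1 (braid_word ?N (map Suc [1..<Suc m]) (braid_word ?N [1..<k] ?y)))"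
    by (rule forms_at_first[OF g f mem2, symmetric])
  also have "\<dots> = form_at (Suc m) f 1 (braid_word (Suc m) [1..<Suc m] (form_at ?N g 1 (braid_word ?N [1..<k] ?y)))"
    by (subst braid_word_form_at_first[OF g _ wk]) auto
  also have "form_at ?N g 1 (braid_word ?N [1..<k] ?y) = left_term n g k x \<odot> P [w]"
  proof -
    have xm: "x \<in> TP (Suc m)" using x n by simp
    have "braid_word ?N [1..<k] ?y = braid_word (Suc m) [1..<k] x \<odot> P [w]"
      by (rule braid_word_mult_right[OF short xm, where b = 1]) auto
    moreover have "form_at ?N g 1 (braid_word (Suc m) [1..<k] x \<odot> P [w]) =
        form_at (Suc m) g 1 (braid_word (Suc m) [1..<k] x) \<odot> P [w]"
      by (rule form_at_mult_right[OF g braid_word_in_power[OF short xm], where b = 1]) auto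
    ultimately show ?thesis by (simp add: left_term_def n)
  qed
  finally show ?thesis
    unfolding arrow_op_eq[OF f lt] .
qed

lemma form_at_second:
  assumes f: "Vector_Spaces.linear scale (*) f" and z: "z \<in> TP 2"
  shows "form_at 2 f 2 z = map_tensor scale 1 1 id (form_map scale f) z"
proof (rule power_split3_eqI[OF _ _ z])
  show "linear_between (TP 2) (TP 1) (form_at 2 f 2)"
    by (rule act_at_linear_between[OF form_map_linear_between[OF f], where a = 1 and b = 0]) auto
  show "linear_between (TP 2) (TP (1 + 0)) (map_tensor scale 1 1 id (form_map scale f))"
    using map_tensor_linear_between[OF linear_between_id[of "TP 1"] form_map_linear_between[OF f]]
    by (simp only: one_add_one)
  show "2 = 0 + 1 + (1::nat)" by simp
  fix a b c assume abc: "a \<in> TP 0" "b \<in> TP 1" "c \<in> TP 1"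
  have ab: "a \<odot> b \<in> TP 1" using mult_in_power[OF abc(1,2)] by simp
  have assoc: "a \<odot> b \<odot> c = (a \<odot> b) \<odot> c"
    by (rule mult_assoc[OF abc[THEN power_in_algebra], symmetric])
  have "form_at 2 f 2 ((a \<odot> b) \<odot> c) = (a \<odot> b) \<odot> form_map scale f c"
    by (rule act_at_last[OF form_map_linear_between[OF f] ab abc(3)]) auto
  moreover have "map_tensor scale 1 1 id (form_map scale f) ((a \<odot> b) \<odot> c) = id (a \<odot> b) \<odot> form_map scale f c"
    by (rule map_tensor_mult[OF linear_between_id form_map_linear_between[OF f] ab abc(3)])
  ultimately show "form_at 2 f 2 (a \<odot> b \<odot> c) = map_tensor scale 1 1 id (form_map scale f) (a \<odot> b \<odot> c)"
    unfolding assoc by (simp only: id_apply)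
qed

text \<open>
  Right compatibility in higher degree: instead of crossing the last factor with \<open>w\<close> and absorbing what
  comes out last, one may absorb the last factor directly and leave \<open>w\<close> in its place.
\<close>

lemma form_at_last_braid_right_compatible:
  assumes f: "Vector_Spaces.linear scale (*) f" and compat: "right_compatible scale \<sigma> w f"
    and y: "y \<in> TP (Suc m)"
  shows "form_at (Suc (Suc m)) f (Suc (Suc m)) (braid_at (Suc (Suc m)) (Suc m) (y \<odot> P [w])) =
    form_at (Suc m) f (Suc m) y \<odot> P [w]"
proof (rule linear_eq_on_power[OF y])
  let ?N = "Suc (Suc m)"
  have w: "P [w] \<in> TP 1" by simp
  have mw: "linear_between (TP (Suc m)) (TP ?N) (\<lambda>y. y \<odot> P [w])"
    using linear_between_mult_left[OF w, of "Suc m"] by simp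
  have sN: "linear_between (TP ?N) (TP ?N) (braid_at ?N (Suc m))" by (rule braid_at_linear_between) auto
  have fN: "linear_between (TP ?N) (TP (Suc m)) (form_at ?N f ?N)"
    by (rule form_at_linear_between[OF f]) auto
  show "linear_between (TP (Suc m)) (TP (Suc m)) (\<lambda>y. form_at ?N f ?N (braid_at ?N (Suc m) (y \<odot> P [w])))"
    by (rule linear_between_comp[OF linear_between_comp[OF mw sN] fN])
  have fm: "linear_between (TP (Suc m)) (TP m) (form_at (Suc m) f (Suc m))"
    by (rule form_at_linear_between[OF f]) auto
  show "linear_between (TP (Suc m)) (TP (m + 1)) (\<lambda>y. form_at (Suc m) f (Suc m) y \<odot> P [w])"
    by (rule linear_between_comp[OF fm linear_between_mult_left[OF w]])
  fix vs :: "'v list" assume "length vs = Suc m"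
  then obtain us v where vs: "vs = us @ [v]" and len: "length us = m"
    by (cases vs rule: rev_cases) auto
  have us: "P us \<in> TP m" and vw: "P [v, w] \<in> TP 2" using len by auto
  have sv: "\<sigma> (P [v, w]) \<in> TP 2" by (rule linear_betweenD(1)[OF sigma_linear_between vw])
  have "P vs \<odot> P [w] = P us \<odot> P [v, w]" by (simp add: vs)
  then have 1: "braid_at ?N (Suc m) (P vs \<odot> P [w]) = P us \<odot> \<sigma> (P [v, w])"
    using act_at_last[OF sigma_linear_between us vw, of ?N "Suc m"] by simp
  have 2: "form_at ?N f ?N (P us \<odot> \<sigma> (P [v, w])) = P us \<odot> form_at 2 f 2 (\<sigma> (P [v, w]))"
    by (rule act_at_pad_left[OF form_map_linear_between[OF f] us sv, where c = 1 and d = 0]) auto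
  have 3: "form_at 2 f 2 (\<sigma> (P [v, w])) = tscale (f v) (P [w])"
    using compat by (simp only: form_at_second[OF f sv] right_compatible_def)
  have 4: "P us \<odot> tscale (f v) (P [w]) = tscale (f v) (P us \<odot> P [w])"
    by (rule mult_scale_right) simp_all
  have "P vs = P us \<odot> P [v]" by (simp add: vs)
  then have "form_at (Suc m) f (Suc m) (P vs) = P us \<odot> form_map scale f (P [v])"
    using act_at_last[OF form_map_linear_between[OF f] us, of "P [v]" "Suc m" "Suc m"] by simp
  then have "form_at (Suc m) f (Suc m) (P vs) = tscale (f v) (P us)"
    by (simp add: form_map_pure[OF f] mult_scale_right)
  then show "form_at ?N f ?N (braid_at ?N (Suc m) (P vs \<odot> P [w])) = form_at (Suc m) f (Suc m) (P vs) \<odot> P [w]"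
    unfolding 1 2 3 4 by (simp only: mult_scale_left)
qed

lemma left_term_mult_right:
  assumes f: "Vector_Spaces.linear scale (*) f" and x: "x \<in> TP n" and k: "k \<in> {1..n}"
  shows "left_term (Suc n) f k (x \<odot> P [w]) = left_term n f k x \<odot> P [w]"
proof -
  have short: "set [1..<k] \<subseteq> {1..<n}" using k by auto
  have "braid_word (Suc n) [1..<k] (x \<odot> P [w]) = braid_word n [1..<k] x \<odot> P [w]"
    by (rule braid_word_mult_right[OF short x, where b = 1]) auto
  moreover have "form_at (Suc n) f 1 (braid_word n [1..<k] x \<odot> P [w]) = form_at n f 1 (braid_word n [1..<k] x) \<odot> P [w]"
    by (rule form_at_mult_right[OF f braid_word_in_power[OF short x], where b = 1]) (use k in auto)
  ultimately show ?thesis by (simp only: left_term_def)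
qed

lemma right_term_mult_right:
  assumes f: "Vector_Spaces.linear scale (*) f" and compat: "right_compatible scale \<sigma> w f"
    and x: "x \<in> TP n" and k: "k \<in> {1..n}"
  shows "right_term (Suc n) f k (x \<odot> P [w]) = right_term n f k x \<odot> P [w]"
proof -
  obtain m where n: "n = Suc m" using k by (cases n) auto
  have x': "x \<in> TP (Suc m)" using x n by simp
  have short: "set (rev [k..<Suc m]) \<subseteq> {1..<Suc m}" using k by auto
  have split: "rev [k..<Suc (Suc m)] = Suc m # rev [k..<Suc m]" using k n by simp
  have "braid_word (Suc (Suc m)) (rev [k..<Suc m]) (x \<odot> P [w]) = braid_word (Suc m) (rev [k..<Suc m]) x \<odot> P [w]"
    by (rule braid_word_mult_right[OF short x', where b = 1]) auto
  then show ?thesis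
    unfolding right_term_def n split foldr.simps comp_apply
    by (simp only: form_at_last_braid_right_compatible[OF f compat braid_word_in_power[OF short x']])
qed

text \<open>
  Here the two forms are applied at opposite ends, so they commute, and the shift identity lets the
  \<open>k\<close>-th factor be pushed to the end before \<open>w\<close> is pulled through.  The first crossing of \<open>w\<close> is then with
  this factor, and right compatibility lets the factor be absorbed without the crossing.
\<close>

lemma right_term_arrow_op:
  assumes f: "Vector_Spaces.linear scale (*) f" and g: "Vector_Spaces.linear scale (*) g"
    and compat: "right_compatible scale \<sigma> w g" and x: "x \<in> TP n" and k: "k \<in> {1..n}"
  shows "right_term n g k (arrow_op scale \<sigma> f w x) = arrow_op scale \<sigma> f w (right_term n g k x)"
proof -
  obtain m where n: "n = Suc m" using k by (cases n) auto
  let ?N = "Suc (Suc m)" and ?y = "x \<odot> P [w]" and ?u = "rev [k..<Suc m]"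
  have y: "?y \<in> TP ?N"
    using mult_in_power[OF x pure_in_power[of "[w]" 1]] by (simp add: n)
  have short: "set ?u \<subseteq> {1..<Suc m}" using k n by auto
  have wy: "braid_word ?N [1..<?N] ?y \<in> TP ?N"
    by (rule braid_word_in_power[OF _ y]) auto
  have uy: "braid_word ?N ?u ?y \<in> TP ?N"
    by (rule braid_word_in_power[OF _ y]) (use short in auto)
  have rt: "right_term n g k x \<in> TP m"
    using linear_betweenD(1)[OF right_term_linear_between[OF g k] x] by (simp add: n)
  have wu: "braid_word ?N [1..<?N] (braid_word ?N ?u ?y) \<in> TP ?N"
    by (rule braid_word_in_power[OF _ uy]) auto
  have su: "braid_at ?N (Suc m) (braid_word ?N ?u ?y) \<in> TP ?N"
    by (rule braid_at_in_power[OF _ _ uy]) auto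
  have split: "[1..<?N] = [1..<Suc m] @ [Suc m]" by simp
  have split_u: "braid_at ?N (Suc m) (braid_word ?N ?u ?y) = braid_word ?N (rev [k..<?N]) ?y"
    using k n by simp
  have "right_term n g k (arrow_op scale \<sigma> f w x) =
      form_at (Suc m) g (Suc m) (braid_word (Suc m) ?u (form_at ?N f 1 (braid_word ?N [1..<?N] ?y)))"
    unfolding right_term_def arrow_op_eq[OF f x] n ..
  also have "\<dots> = form_at (Suc m) g (Suc m) (form_at ?N f 1 (braid_word ?N (map Suc ?u) (braid_word ?N [1..<?N] ?y)))"
    by (subst braid_word_form_at_first[OF f short wy]) (rule refl)
  also have "\<dots> = form_at (Suc m) g (Suc m) (form_at ?N f 1 (braid_word ?N [1..<?N] (braid_word ?N ?u ?y)))"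
    by (subst braid_word_shift[OF short y]) (rule refl)
  also have "\<dots> = form_at (Suc m) f 1 (form_at ?N g ?N (braid_word ?N [1..<?N] (braid_word ?N ?u ?y)))"
    by (rule form_at_last_first[OF f g wu])
  also have "\<dots> = form_at (Suc m) f 1 (form_at ?N g ?N (braid_word ?N [1..<Suc m] (braid_at ?N (Suc m) (braid_word ?N ?u ?y))))"
    unfolding split foldr_append by (simp only: foldr.simps comp_apply id_apply)
  also have "\<dots> = form_at (Suc m) f 1 (braid_word (Suc m) [1..<Suc m] (form_at ?N g ?N (braid_at ?N (Suc m) (braid_word ?N ?u ?y))))"
    by (subst form_at_last_braid_word[OF g _ su]) auto
  also have "\<dots> = form_at (Suc m) f 1 (braid_word (Suc m) [1..<Suc m] (right_term ?N g k ?y))"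
    by (simp only: split_u right_term_def)
  also have "\<dots> = form_at (Suc m) f 1 (braid_word (Suc m) [1..<Suc m] (right_term n g k x \<odot> P [w]))"
    using right_term_mult_right[OF g compat x k] by (simp only: n)
  finally show ?thesis
    unfolding arrow_op_eq[OF f rt] .
qed

lemma left_d_arrow_op:
  assumes f: "Vector_Spaces.linear scale (*) f" and g: "Vector_Spaces.linear scale (*) g"
    and compat: "\<And>y. y \<in> TP 2 \<Longrightarrow> form2 scale f g (\<sigma> y) = form2 scale g f y"
    and x: "x \<in> TP n"
  shows "left_d scale \<sigma> g (arrow_op scale \<sigma> f w x) = arrow_op scale \<sigma> f w (left_d scale \<sigma> g x)"
proof -
  have lin: "linear_between (TP (n - 1)) UNIV (arrow_op scale \<sigma> f w)"
    by (rule linear_between_linearI[OF arrow_op_linear]) simp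
  have mem: "left_term n g k x \<in> TP (n - 1)" if "k \<in> {1..n}" for k
    by (rule linear_betweenD(1)[OF left_term_linear_between[OF g that] x])
  have "left_d scale \<sigma> g (arrow_op scale \<sigma> f w x) =
      (\<Sum>k\<in>{1..n}. tscale ((- 1) ^ (k - 1)) (left_term n g k (arrow_op scale \<sigma> f w x)))"
    by (rule left_d_eq[OF g arrow_op_in_power[OF f x]])
  also have "\<dots> = (\<Sum>k\<in>{1..n}. tscale ((- 1) ^ (k - 1)) (arrow_op scale \<sigma> f w (left_term n g k x)))"
    by (rule sum.cong[OF refl]) (simp only: left_term_arrow_op[OF f g compat x])
  also have "\<dots> = arrow_op scale \<sigma> f w (left_d scale \<sigma> g x)"
    unfolding left_d_eq[OF g x] by (rule linear_between_of_sum[OF lin mem, symmetric])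
  finally show ?thesis .
qed

lemma right_d_arrow_op:
  assumes f: "Vector_Spaces.linear scale (*) f" and g: "Vector_Spaces.linear scale (*) g"
    and compat: "right_compatible scale \<sigma> w g" and x: "x \<in> TP n"
  shows "right_d scale \<sigma> g (arrow_op scale \<sigma> f w x) = arrow_op scale \<sigma> f w (right_d scale \<sigma> g x)"
proof -
  have lin: "linear_between (TP (n - 1)) UNIV (arrow_op scale \<sigma> f w)"
    by (rule linear_between_linearI[OF arrow_op_linear]) simp
  have mem: "right_term n g k x \<in> TP (n - 1)" if "k \<in> {1..n}" for k
    by (rule linear_betweenD(1)[OF right_term_linear_between[OF g that] x])
  have "right_d scale \<sigma> g (arrow_op scale \<sigma> f w x) =
      (\<Sum>k\<in>{1..n}. tscale ((- 1) ^ (k - 1)) (right_term n g k (arrow_op scale \<sigma> f w x)))"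
    by (rule right_d_eq[OF g arrow_op_in_power[OF f x]])
  also have "\<dots> = (\<Sum>k\<in>{1..n}. tscale ((- 1) ^ (k - 1)) (arrow_op scale \<sigma> f w (right_term n g k x)))"
    by (rule sum.cong[OF refl]) (simp only: right_term_arrow_op[OF f g compat x])
  also have "\<dots> = arrow_op scale \<sigma> f w (right_d scale \<sigma> g x)"
    unfolding right_d_eq[OF g x] by (rule linear_between_of_sum[OF lin mem, symmetric])
  finally show ?thesis .
qed


section \<open>The bicomplex map, appending the element, and demi-naturality\<close>

lemma bicomplex_map_arrow_op:
  assumes f: "Vector_Spaces.linear scale (*) f" and g: "Vector_Spaces.linear scale (*) g"
    and h: "Vector_Spaces.linear scale (*) h"
    and compat_fg: "\<And>y. y \<in> TP 2 \<Longrightarrow> form2 scale f g (\<sigma> y) = form2 scale g f y"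
    and compat: "right_compatible scale \<sigma> w h"
  shows "bicomplex_map scale (left_d scale \<sigma> g) (right_d scale \<sigma> h) (arrow_op scale \<sigma> f w)"
proof -
  let ?\<pi> = "arrow_op scale \<sigma> f w" and ?l = "left_d scale \<sigma> g" and ?r = "right_d scale \<sigma> h"
  have "Vector_Spaces.linear tscale tscale ?l" "Vector_Spaces.linear tscale tscale ?r"
    unfolding left_d_def right_d_def assemble_def by (rule linear_lin_ext)+
  note linear = this[THEN linear_tscaleD(1)] this[THEN linear_tscaleD(2)]
    linear_tscaleD[OF arrow_op_linear, of f w]
  have "x \<in> TA \<Longrightarrow> ?\<pi> x \<in> TA \<and> ?l (?\<pi> x) = ?\<pi> (?l x) \<and> ?r (?\<pi> x) = ?\<pi> (?r x)" for x
  proof (induction rule: algebra_induct)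
    case zero
    have "?\<pi> 0 = 0" "?l 0 = 0" "?r 0 = 0"
      using linear(3,4,6)[of 0 0] by simp_all
    then show ?case by simp
  next
    case (add c vs y)
    have vs: "P vs \<in> TP (length vs)" by simp
    show ?case
      using add power_in_algebra[OF arrow_op_in_power[OF f vs, of w]]
        left_d_arrow_op[OF f g compat_fg vs] right_d_arrow_op[OF f h compat vs]
      by (simp add: linear add_in_algebra scale_in_algebra)
  qed
  then show ?thesis
    unfolding bicomplex_map_def
    by (auto intro: linear_between_linearI[OF arrow_op_linear] arrow_op_in_power[OF f])
qed

text \<open>
  The terms for the old factors do not touch \<open>w\<close>.  The one new term pulls \<open>w\<close> itself to the front, which
  is the arrow operation.
\<close>

lemma left_d_mult_right:
  assumes f: "Vector_Spaces.linear scale (*) f" and x: "x \<in> TP n"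
  shows "left_d scale \<sigma> f (x \<odot> P [w]) =
    left_d scale \<sigma> f x \<odot> P [w] + tscale ((- 1) ^ n) (arrow_op scale \<sigma> f w x)"
proof -
  have y: "x \<odot> P [w] \<in> TP (Suc n)"
    using mult_in_power[OF x pure_in_power[of "[w]" 1]] by simp
  have mem: "left_term n f k x \<in> TP (n - 1)" if "k \<in> {1..n}" for k
    by (rule linear_betweenD(1)[OF left_term_linear_between[OF f that] x])
  have w: "P [w] \<in> TP 1" by simp
  have "left_d scale \<sigma> f (x \<odot> P [w]) =
      (\<Sum>k\<in>{1..n}. tscale ((- 1) ^ (k - 1)) (left_term (Suc n) f k (x \<odot> P [w])))
      + tscale ((- 1) ^ n) (left_term (Suc n) f (Suc n) (x \<odot> P [w]))"
    unfolding left_d_eq[OF f y] by (simp del: One_nat_def)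
  also have "(\<Sum>k\<in>{1..n}. tscale ((- 1) ^ (k - 1)) (left_term (Suc n) f k (x \<odot> P [w]))) =
      (\<Sum>k\<in>{1..n}. tscale ((- 1) ^ (k - 1)) (left_term n f k x \<odot> P [w]))"
    by (rule sum.cong[OF refl]) (simp only: left_term_mult_right[OF f x])
  also have "\<dots> = left_d scale \<sigma> f x \<odot> P [w]"
    unfolding left_d_eq[OF f x]
    by (rule linear_between_of_sum[OF linear_between_mult_left[OF w] mem, symmetric])
  also have "left_term (Suc n) f (Suc n) (x \<odot> P [w]) = arrow_op scale \<sigma> f w x"
    by (simp only: left_term_def arrow_op_eq[OF f x])
  finally show ?thesis .
qed

text \<open>
  Each old factor has one more crossing to make, with \<open>w\<close>, and right compatibility removes it.  In the
  new term \<open>w\<close> is already at the end and is absorbed at once.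
\<close>

lemma right_d_mult_right:
  assumes f: "Vector_Spaces.linear scale (*) f" and compat: "right_compatible scale \<sigma> w f"
    and x: "x \<in> TP n"
  shows "right_d scale \<sigma> f (x \<odot> P [w]) =
    right_d scale \<sigma> f x \<odot> P [w] + tscale ((- 1) ^ n * f w) x"
proof -
  have w: "P [w] \<in> TP 1" by simp
  have y: "x \<odot> P [w] \<in> TP (Suc n)"
    using mult_in_power[OF x w] by simp
  have mem: "right_term n f k x \<in> TP (n - 1)" if "k \<in> {1..n}" for k
    by (rule linear_betweenD(1)[OF right_term_linear_between[OF f that] x])
  have "form_at (Suc n) f (Suc n) (x \<odot> P [w]) = x \<odot> form_map scale f (P [w])"
    by (rule act_at_last[OF form_map_linear_between[OF f] x w]) auto
  also have "\<dots> = tscale (f w) x"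
    using x by (simp only: form_map_pure[OF f] mult_scale_right[OF power_in_algebra[OF x] pure_in_algebra]
        mult_unit[OF power_in_algebra[OF x]])
  finally have last: "right_term (Suc n) f (Suc n) (x \<odot> P [w]) = tscale (f w) x"
    by (simp add: right_term_def)
  have "right_d scale \<sigma> f (x \<odot> P [w]) =
      (\<Sum>k\<in>{1..n}. tscale ((- 1) ^ (k - 1)) (right_term (Suc n) f k (x \<odot> P [w])))
      + tscale ((- 1) ^ n) (right_term (Suc n) f (Suc n) (x \<odot> P [w]))"
    unfolding right_d_eq[OF f y] by (simp del: One_nat_def)
  also have "(\<Sum>k\<in>{1..n}. tscale ((- 1) ^ (k - 1)) (right_term (Suc n) f k (x \<odot> P [w]))) =
      (\<Sum>k\<in>{1..n}. tscale ((- 1) ^ (k - 1)) (right_term n f k x \<odot> P [w]))"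
    by (rule sum.cong[OF refl]) (simp only: right_term_mult_right[OF f compat x])
  also have "\<dots> = right_d scale \<sigma> f x \<odot> P [w]"
    unfolding right_d_eq[OF f x]
    by (rule linear_between_of_sum[OF linear_between_mult_left[OF w] mem, symmetric])
  finally show ?thesis by (simp only: last T.scale_scale)
qed

lemma arrow_op_demi_natural:
  assumes f: "Vector_Spaces.linear scale (*) f" and nat: "demi_natural scale \<sigma> w" and x: "x \<in> TA"
  shows "arrow_op scale \<sigma> f w x = tscale (f w) x"
  using x
proof (induction rule: algebra_induct)
  case zero
  show ?case
    using linear_tscaleD(2)[OF arrow_op_linear, of f w 0 0] by simp
next
  case (add c vs y)
  define n where "n = length vs"
  have vs: "P vs \<in> TP n" by (simp add: n_def)
  \<comment> \<open>With \<open>w\<close> at the end, the word starting at position \<open>Suc (length us)\<close> carries it back just to \<open>us\<close>.\<close>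
  have move: "braid_word (Suc n) [Suc (length us)..<Suc n] (P (us @ zs @ [w])) = P (us @ w # zs)"
    if "us @ zs = vs" for us zs
    using that
  proof (induction zs arbitrary: us)
    case Nil
    then show ?case by (simp add: n_def)
  next
    case (Cons z zs)
    have "Suc (length us) < Suc n" using Cons.prems by (auto simp: n_def)
    then have "braid_word (Suc n) [Suc (length us)..<Suc n] (P (us @ (z # zs) @ [w])) =
        braid_at (Suc n) (Suc (length us)) (braid_word (Suc n) [Suc (length (us @ [z]))..<Suc n] (P ((us @ [z]) @ zs @ [w])))"
      by (simp add: upt_conv_Cons del: upt_Suc)
    also have "\<dots> = braid_at (Suc n) (Suc (length us)) (P ((us @ [z]) @ w # zs))"
      using Cons.IH[of "us @ [z]"] Cons.prems by simp
    also have "P ((us @ [z]) @ w # zs) = P us \<odot> P [z, w] \<odot> P zs"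
      by simp
    also have "braid_at (Suc n) (Suc (length us)) (P us \<odot> P [z, w] \<odot> P zs) = P us \<odot> \<sigma> (P [z, w]) \<odot> P zs"
      by (rule act_at_mult[OF sigma_linear_between]) (use Cons.prems in \<open>auto simp: n_def\<close>)
    also have "\<dots> = P (us @ w # z # zs)"
      using nat by (simp add: demi_natural_def)
    finally show ?case .
  qed
  have "arrow_op scale \<sigma> f w (P vs) = form_at (Suc n) f 1 (braid_word (Suc n) [1..<Suc n] (P (vs @ [w])))"
    unfolding arrow_op_eq[OF f vs] by (simp only: pure_mult_pure)
  also have "braid_word (Suc n) [1..<Suc n] (P (vs @ [w])) = P (w # vs)"
    using move[of "[]" vs] by simp
  also have "form_at (Suc n) f 1 (P (w # vs)) = tscale (f w) (P vs)"
    by (rule form_at_first_pure[OF f]) (simp add: n_def)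
  finally have pure: "arrow_op scale \<sigma> f w (P vs) = tscale (f w) (P vs)" .
  show ?case
    by (simp add: linear_tscaleD[OF arrow_op_linear] pure add.IH T.scale_right_distrib mult.commute)
qed

end

theorem proposition3p9:
  fixes scale :: "'k::field \<Rightarrow> 'v::ab_group_add \<Rightarrow> 'v"
    and \<sigma> :: "('k, 'v) tensor \<Rightarrow> ('k, 'v) tensor"
    and \<epsilon> \<xi> \<zeta> :: "'v \<Rightarrow> 'k" and w :: 'v
  assumes "vector_space scale"
    and "pre_braiding scale \<sigma>"
    and "braided_character scale \<sigma> \<epsilon>"
    and "braided_character scale \<sigma> \<xi>"
    and "braided_character scale \<sigma> \<zeta>"
    and "compatible_forms scale \<sigma> \<epsilon> \<xi>"
    and "right_compatible scale \<sigma> w \<zeta>"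
  shows
    "(bicomplex_map scale (left_d scale \<sigma> \<xi>) (right_d scale \<sigma> \<zeta>) (arrow_op scale \<sigma> \<epsilon> w) \<and>
      (\<forall>n. \<forall>vs. length vs = n \<longrightarrow>
        left_d scale \<sigma> \<xi> (arrow_op scale \<sigma> \<epsilon> w (pure_tensor scale vs)) =
          arrow_op scale \<sigma> \<epsilon> w (left_d scale \<sigma> \<xi> (pure_tensor scale vs)) \<and>
        right_d scale \<sigma> \<zeta> (arrow_op scale \<sigma> \<epsilon> w (pure_tensor scale vs)) =
          arrow_op scale \<sigma> \<epsilon> w (right_d scale \<sigma> \<zeta> (pure_tensor scale vs)))) \<and>
     (\<forall>n. \<forall>vs. length vs = n \<longrightarrow>
        left_d scale \<sigma> \<epsilon> (tensor_mult scale (pure_tensor scale vs) (pure_tensor scale [w])) =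
          tensor_mult scale (left_d scale \<sigma> \<epsilon> (pure_tensor scale vs)) (pure_tensor scale [w]) +
          tscale ((-1) ^ n) (arrow_op scale \<sigma> \<epsilon> w (pure_tensor scale vs)) \<and>
        right_d scale \<sigma> \<zeta> (tensor_mult scale (pure_tensor scale vs) (pure_tensor scale [w])) =
          tensor_mult scale (right_d scale \<sigma> \<zeta> (pure_tensor scale vs)) (pure_tensor scale [w]) +
          tscale ((-1) ^ n * \<zeta> w) (pure_tensor scale vs)) \<and>
     (demi_natural scale \<sigma> w \<longrightarrow>
        (\<forall>x\<in>tensor_algebra scale. arrow_op scale \<sigma> \<epsilon> w x = tscale (\<epsilon> w) x))"
proof -
  interpret pre_braided scale \<sigma>
    using assms(1,2) by (simp add: pre_braided_def tensor_space_def pre_braided_axioms_def)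
  have linear: "Vector_Spaces.linear scale (*) \<epsilon>" "Vector_Spaces.linear scale (*) \<xi>"
      "Vector_Spaces.linear scale (*) \<zeta>"
    using assms(3-5) by (simp_all add: braided_character_def)
  have compat: "form2 scale \<epsilon> \<xi> (\<sigma> y) = form2 scale \<xi> \<epsilon> y" if "y \<in> tensor_power scale 2" for y
    using assms(6) that by (simp add: compatible_forms_def)
  have bi: "bicomplex_map scale (left_d scale \<sigma> \<xi>) (right_d scale \<sigma> \<zeta>) (arrow_op scale \<sigma> \<epsilon> w)"
    by (rule bicomplex_map_arrow_op[OF linear compat assms(7)])
  show ?thesis
    by (intro conjI allI impI ballI bi left_d_arrow_op[OF linear(1,2) compat]
        right_d_arrow_op[OF linear(1,3) assms(7)] left_d_mult_right[OF linear(1)]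
        right_d_mult_right[OF linear(3) assms(7)] arrow_op_demi_natural[OF linear(1)] pure_in_power)
qed

end
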